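(* Let $x_1<x_2<\dots<x_n$ be real numbers and $y_1,\dots,y_n\in\mathbb{R}$. Assume $x_1<0$ and $x_n\ge0$, and let $i_0=\min\{i\in\{1,\dots,n\}: x_i\ge0\}$. Then, with the set $\Lambda\subset\mathbb{R}^2$ and the functions $g_i$, $c_i$ defined in the context, $$\min_{f:\ \forall i\in\{1,\dots,n\},\ f(x_i)=y_i}\big\|\sqrt{1+x^2}f''\big\|_{\mathrm{TV}}=\min_{(s_{i_0-1},s_{i_0})\in\Lambda}\ g_{i_0}(s_{i_0},s_{i_0-1})+c_{i_0-1}(s_{i_0-1})+c_{i_0}(s_{i_0}).$$
   Context: For a Lipschitz function $f:\mathbb{R}\to\mathbb{R}$, $f''$ is its distributional second derivative. If $f''$ is a signed Radon measure with total variation measure $|f''|$, then $\|\sqrt{1+x^2}f''\|_{\mathrm{TV}}=\int_{\mathbb{R}}\sqrt{1+x^2}\,\mathrm{d}|f''|(x)$; for every other function $f:\mathbb{R}\to\mathbb{R}$ this quantity is $+\infty$. For $i\in\{1,\dots,n-1\}$ let $\delta_i=\frac{y_{i+1}-y_i}{x_{i+1}-x_i}$ and, for $(s_{i+1},s_i)\in\mathbb{R}^2$, $$g_{i+1}(s_{i+1},s_i)=\sqrt{\big(x_{i+1}(s_{i+1}-\delta_i)-x_i(s_i-\delta_i)\big)^2+(s_{i+1}-s_i)^2}.$$ For $s\in\mathbb{R}$ let $S_i(s)=(-\infty,\delta_i]$ if $s>\delta_i$, $S_i(s)=\{\delta_i\}$ if $s=\delta_i$, and $S_i(s)=[\delta_i,+\infty)$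 if $s<\delta_i$. Let $$\Lambda=\big((-\infty,\delta_{i_0-1})\times(\delta_{i_0-1},+\infty)\big)\cup\{(\delta_{i_0-1},\delta_{i_0-1})\}\cup\big((\delta_{i_0-1},+\infty)\times(-\infty,\delta_{i_0-1})\big).$$ The functions $c_i:\mathbb{R}\to\mathbb{R}_+$ are defined recursively by $c_1=c_n\equiv0$ and $$c_{i+1}(s_{i+1})=\min_{s_i\in S_i(s_{i+1})} g_{i+1}(s_{i+1},s_i)+c_i(s_i)\quad\text{for } i\in\{1,\dots,i_0-2\},$$ $$c_i(s_i)=\min_{s_{i+1}\in S_i(s_i)} g_{i+1}(s_{i+1},s_i)+c_{i+1}(s_{i+1})\quad\text{for } i\in\{i_0,\dots,n-1\}.$$ *)

theory Defs
  imports "HOL-Analysis.Analysis"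
begin

definition test_function :: "(real \<Rightarrow> real) \<Rightarrow> bool" where
  "test_function \<phi> \<longleftrightarrow>
     (\<forall>k t. (deriv ^^ k) \<phi> field_differentiable at t) \<and> compact (closure {t. \<phi> t \<noteq> 0})"

(* On the real line, inner regularity follows from finiteness on compact sets. *)
definition radon_measure :: "real measure \<Rightarrow> bool" where
  "radon_measure M \<longleftrightarrow> sets M = sets borel \<and> (\<forall>K. compact K \<longrightarrow> emeasure M K < \<infinity>)"

(* A signed Radon measure is given by its Jordan decomposition (P, N), that is, it is P - N with
   P and N mutually singular.  As P and N need only be locally finite, P - N is in general not
   defined as a real-valued function on all Borel sets. *)
type_synonym signed_measure = "real measure \<times> real measure"

definition signed_radon_measure :: "signed_measure \<Rightarrow> bool" where
  "signed_radon_measure \<mu> \<longleftrightarrow>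
     radon_measure (fst \<mu>) \<and> radon_measure (snd \<mu>) \<and>
     (\<exists>A \<in> sets borel. emeasure (fst \<mu>) (- A) = 0 \<and> emeasure (snd \<mu>) A = 0)"

definition signed_integral :: "signed_measure \<Rightarrow> (real \<Rightarrow> real) \<Rightarrow> real" where
  "signed_integral \<mu> \<phi> = (LINT t|fst \<mu>. \<phi> t) - (LINT t|snd \<mu>. \<phi> t)"

definition total_variation :: "signed_measure \<Rightarrow> real measure" where
  "total_variation \<mu> =
     measure_of UNIV (sets borel) (\<lambda>A. emeasure (fst \<mu>) A + emeasure (snd \<mu>) A)"

definition second_distr_deriv :: "(real \<Rightarrow> real) \<Rightarrow> signed_measure \<Rightarrow> bool" where
  "second_distr_deriv f \<mu> \<longleftrightarrow>
     signed_radon_measure \<mu> \<and>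
     (\<forall>\<phi>. test_function \<phi> \<longrightarrow>
        (LINT t|lborel. f t * (deriv ^^ 2) \<phi> t) = signed_integral \<mu> \<phi>)"

(* The description is well defined: a signed Radon measure is determined by its action on test
   functions, and its Jordan decomposition is unique. *)
definition weighted_TV :: "(real \<Rightarrow> real) \<Rightarrow> ennreal" where
  "weighted_TV f =
     (if (\<exists>L. L-lipschitz_on UNIV f) \<and> (\<exists>\<mu>. second_distr_deriv f \<mu>)
      then \<integral>\<^sup>+ t. ennreal (sqrt (1 + t\<^sup>2)) \<partial>total_variation (THE \<mu>. second_distr_deriv f \<mu>)
      else \<infinity>)"

definition slope :: "(nat \<Rightarrow> real) \<Rightarrow> (nat \<Rightarrow> real) \<Rightarrow> nat \<Rightarrow> real" where
  "slope x y i = (y (i + 1) - y i) / (x (i + 1) - x i)"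

(* This is g_j(t, s), where t is the slope at x_j and s the slope at x_{j-1}; used for j \<ge> 2. *)
definition seg_cost :: "(nat \<Rightarrow> real) \<Rightarrow> (nat \<Rightarrow> real) \<Rightarrow> nat \<Rightarrow> real \<Rightarrow> real \<Rightarrow> real" where
  "seg_cost x y j t s =
     sqrt ((x j * (t - slope x y (j - 1)) - x (j - 1) * (s - slope x y (j - 1)))\<^sup>2 + (t - s)\<^sup>2)"

definition opp_slopes :: "(nat \<Rightarrow> real) \<Rightarrow> (nat \<Rightarrow> real) \<Rightarrow> nat \<Rightarrow> real \<Rightarrow> real set" where
  "opp_slopes x y i s =
     (if s > slope x y i then {..slope x y i}
      else if s = slope x y i then {slope x y i}
      else {slope x y i..})"

definition Lambda :: "(nat \<Rightarrow> real) \<Rightarrow> (nat \<Rightarrow> real) \<Rightarrow> nat \<Rightarrow> (real \<times> real) set" where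
  "Lambda x y i0 =
     (let d = slope x y (i0 - 1) in {..<d} \<times> {d<..} \<union> {(d, d)} \<union> {d<..} \<times> {..<d})"

(* This is c_i(s), for 1 \<le> i \<le> n.  The recursion runs upwards from i = 1 when i < i0 and downwards
   from i = n when i \<ge> i0.  The term "LEAST m. m \<in> A" is the minimum of A. *)
function tail_cost ::
  "(nat \<Rightarrow> real) \<Rightarrow> (nat \<Rightarrow> real) \<Rightarrow> nat \<Rightarrow> nat \<Rightarrow> nat \<Rightarrow> real \<Rightarrow> real" where
  "tail_cost x y n i0 i s =
     (if i \<le> 1 \<or> n \<le> i then 0
      else if i < i0 then
        (LEAST m. m \<in> (\<lambda>r. seg_cost x y i s r + tail_cost x y n i0 (i - 1) r)
                        ` opp_slopes x y (i - 1) s)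
      else
        (LEAST m. m \<in> (\<lambda>r. seg_cost x y (i + 1) r s + tail_cost x y n i0 (i + 1) r)
                        ` opp_slopes x y i s))"
  by pat_completeness auto
termination
  by (relation "Wellfounded.measure (\<lambda>(x, y, n, i0, i, s). if i < i0 then i else n - i)") auto

declare tail_cost.simps [simp del]

end

theory Submission
  imports Defs "HOL-Real_Asymp.Real_Asymp"
begin

text \<open>Let \<open>\<mu> = f''\<close>. On a segment \<open>[p, q)\<close> between consecutive knots, the values of \<open>f\<close> at the knots
  together with the left derivatives there, which exceed the slope of the chord by \<open>a\<close> and \<open>b\<close>,
  prescribe the two moments \<open>\<integral>d\<mu> = b - a\<close> and \<open>\<integral>u d\<mu> = q b - p a\<close>. Integrating an affine function
  bounded by \<open>sqrt (1 + u\<^sup>2)\<close> therefore bounds the cost of the segment from below. If \<open>a\<close> and \<open>b\<close> have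
  opposite signs, the best such bound is attained by a single kink; if they have the same sign, it is
  the cost of two kinks at the knots themselves. The latter case never helps: the optimal costs \<open>c\<^sub>i\<close>
  are Lipschitz with constant \<open>sqrt (1 + x\<^sub>i\<^sup>2)\<close>, so a kink at a knot can be charged to the neighbouring
  segment. The same argument shows that the boundary of \<open>\<Lambda>\<close> can be ignored.\<close>

subsection \<open>Smooth functions and mollified ramps\<close>

text \<open>A kink of mass m at z has the moments m * (z, 1), a vector of Euclidean length
  \<open>\<bar>m\<bar> * sqrt (1 + z\<^sup>2)\<close>. Hence every cost here is a Euclidean norm,
  and costs are compared by triangle inequalities. The obstacle is that a competitor
  \<open>f\<close> is known only through smooth test functions, whereas the argument needs moments
  over half-open segments and one-sided derivatives at knots. Differentiability of \<open>f\<close>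
  is never proved: the pairing is extended to compactly supported piecewise affine functions, and a
  function playing the role of the left derivative is then read off from \<mu>. Half-open segments
  ensure that an atom at a knot is charged to at most one segment. The slopes of a competitor obey
  no sign condition, so the lower bound has to cover all slope sequences;
  \<open>segment_cost\<close> extends the one-kink cost for that purpose. Two debts come from the
  definitions: \<open>weighted_TV\<close> selects the derivative with \<open>THE\<close>, which
  calls for uniqueness of the Jordan pair, and \<open>tail_cost\<close> takes \<open>LEAST\<close>
  over a set of reals, which calls for attained minima.\<close>

primrec diff_upto :: "nat \<Rightarrow> (real \<Rightarrow> real) \<Rightarrow> bool" where
  "diff_upto 0 h \<longleftrightarrow> (\<forall>t. h field_differentiable at t)"
| "diff_upto (Suc k) h \<longleftrightarrow> (\<forall>t. h field_differentiable at t) \<and> diff_upto k (deriv h)"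

definition smooth :: "(real \<Rightarrow> real) \<Rightarrow> bool" where
  "smooth h \<longleftrightarrow> (\<forall>k. diff_upto k h)"

text \<open>\<open>diff_upto\<close> strips the innermost derivative, so that inductions on the
  order can generalise over the function; \<open>test_function\<close> iterates from the
  outside.\<close>

lemma diff_upto_iff: "diff_upto k h \<longleftrightarrow> (\<forall>j\<le>k. \<forall>t. (deriv ^^ j) h field_differentiable at t)"
proof (induction k arbitrary: h)
  case (Suc k)
  have "(\<forall>j\<le>Suc k. \<forall>t. (deriv ^^ j) h field_differentiable at t) \<longleftrightarrow>
    (\<forall>t. (deriv ^^ 0) h field_differentiable at t) \<and>
    (\<forall>j\<le>k. \<forall>t. (deriv ^^ Suc j) h field_differentiable at t)"
    by (metis Suc_le_mono le0 not0_implies_Suc)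
  then show ?case
    by (simp add: Suc funpow_Suc_right del: funpow.simps(2))
qed simp

lemma test_function_iff: "test_function \<phi> \<longleftrightarrow> smooth \<phi> \<and> compact (closure {t. \<phi> t \<noteq> 0})"
  unfolding test_function_def smooth_def diff_upto_iff by auto

lemma smoothD: "smooth h \<Longrightarrow> (h has_real_derivative deriv h t) (at t)"
  unfolding smooth_def using diff_upto.simps(1) DERIV_deriv_iff_field_differentiable by blast

lemma smooth_deriv: "smooth h \<Longrightarrow> smooth (deriv h)"
  unfolding smooth_def by (meson diff_upto.simps(2))

lemma smooth_continuous: "smooth h \<Longrightarrow> continuous_on A h"
  by (meson DERIV_isCont continuous_at_imp_continuous_on smoothD)

lemma smooth_measurable: "smooth h \<Longrightarrow> h \<in> borel_measurable borel"
  by (intro borel_measurable_continuous_onI smooth_continuous)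

lemma diff_upto_SucI:
  assumes "\<And>t. (h has_real_derivative h' t) (at t)" "diff_upto k h'"
  shows "diff_upto (Suc k) h"
proof -
  have "deriv h = h'"
    using assms(1) by (auto intro: DERIV_imp_deriv)
  with assms show ?thesis
    by (auto simp: field_differentiable_def)
qed

lemma diff_upto_Suc_imp: "diff_upto (Suc k) h \<Longrightarrow> diff_upto k h"
  unfolding diff_upto_iff by auto

lemma diff_upto_DERIV: "diff_upto k h \<Longrightarrow> (h has_real_derivative deriv h t) (at t)"
  by (cases k) (auto simp: DERIV_deriv_iff_field_differentiable)

lemma smoothI:
  assumes "\<And>t. (h has_real_derivative h' t) (at t)" "smooth h'"
  shows "smooth h"
  using assms diff_upto_SucI diff_upto_Suc_imp unfolding smooth_def by blast

text \<open>Smooth functions form the largest class closed under differentiation. Families such as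
  sums or rescalings are closed by inspection, which spares a formula for their higher
  derivatives.\<close>

lemma smooth_coinduct:
  assumes "h \<in> S" "\<And>h. h \<in> S \<Longrightarrow> \<exists>h'\<in>S. \<forall>t. (h has_real_derivative h' t) (at t)"
  shows "smooth h"
proof -
  have "\<forall>h\<in>S. diff_upto k h" for k
  proof (induction k)
    case 0
    then show ?case
      using assms(2) unfolding diff_upto.simps field_differentiable_def by blast
  next
    case (Suc k)
    show ?case
    proof
      fix h assume "h \<in> S"
      then obtain h' where "h' \<in> S" "\<And>t. (h has_real_derivative h' t) (at t)"
        using assms(2) by blast
      then show "diff_upto (Suc k) h"
        using Suc diff_upto_SucI[of h h'] by blast
    qed
  qed
  then show ?thesis
    using assms(1) by (auto simp: smooth_def)
qed

lemma smooth_const: "smooth (\<lambda>_. c)"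
  by (rule smooth_coinduct[of _ "range (\<lambda>c _. c)"]) (auto intro!: derivative_eq_intros)

lemma smooth_add:
  assumes "smooth f" "smooth g"
  shows "smooth (\<lambda>t. f t + g t)"
proof (rule smooth_coinduct[of _ "{\<lambda>t. f t + g t |f g. smooth f \<and> smooth g}"])
  fix h assume "h \<in> {\<lambda>t. f t + g t |f g. smooth f \<and> smooth g}"
  then obtain f g where "h = (\<lambda>t. f t + g t)" "smooth f" "smooth g" by blast
  then show "\<exists>h'\<in>{\<lambda>t. f t + g t |f g. smooth f \<and> smooth g}. \<forall>t. (h has_real_derivative h' t) (at t)"
    by (intro bexI[of _ "\<lambda>t. deriv f t + deriv g t"])
      (auto intro!: DERIV_add smoothD smooth_deriv)
qed (use assms in auto)

lemma smooth_affine: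
  assumes "smooth f"
  shows "smooth (\<lambda>t. c * f (a * t + b))"
proof (rule smooth_coinduct[of _ "{\<lambda>t. c * f (a * t + b) |c f. smooth f}"])
  fix h assume "h \<in> {\<lambda>t. c * f (a * t + b) |c f. smooth f}"
  then obtain c f where h: "h = (\<lambda>t. c * f (a * t + b))" "smooth f" by blast
  have "(h has_real_derivative (c * a) * deriv f (a * t + b)) (at t)" for t
    unfolding h(1)
    by (rule derivative_eq_intros DERIV_chain2[OF smoothD[OF h(2)]] refl | simp)+
  then show "\<exists>h'\<in>{\<lambda>t. c * f (a * t + b) |c f. smooth f}. \<forall>t. (h has_real_derivative h' t) (at t)"
    by (intro bexI[of _ "\<lambda>t. (c * a) * deriv f (a * t + b)"])
      (use smooth_deriv[OF h(2)] in blast)+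
qed (use assms in auto)

lemma smooth_sum:
  assumes "\<And>i. i \<in> I \<Longrightarrow> smooth (f i)"
  shows "smooth (\<lambda>t. \<Sum>i\<in>I. f i t)"
  using assms
  by (induction I rule: infinite_finite_induct) (auto simp: smooth_const smooth_add)

lemma diff_upto_add: "diff_upto k f \<Longrightarrow> diff_upto k g \<Longrightarrow> diff_upto k (\<lambda>t. f t + g t)"
proof (induction k arbitrary: f g)
  case 0
  then show ?case by (auto intro: field_differentiable_add)
next
  case (Suc k)
  show ?case
    by (rule diff_upto_SucI[OF DERIV_add[OF diff_upto_DERIV[OF Suc.prems(1)] diff_upto_DERIV[OF Suc.prems(2)]]])
      (use Suc in auto)
qed

text \<open>Products are not closed under differentiation, as the product rule yields a sum of two
  of them; hence an induction on the order, with \<open>diff_upto_add\<close> for that sum.\<close>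

lemma smooth_mult:
  assumes "smooth f" "smooth g"
  shows "smooth (\<lambda>t. f t * g t)"
proof -
  have "diff_upto k f \<Longrightarrow> diff_upto k g \<Longrightarrow> diff_upto k (\<lambda>t. f t * g t)" for k f g
  proof (induction k arbitrary: f g)
    case 0
    then show ?case by (auto intro: field_differentiable_mult)
  next
    case (Suc k)
    have "diff_upto k (\<lambda>t. deriv f t * g t + deriv g t * f t)"
      using Suc diff_upto_Suc_imp by (intro diff_upto_add) auto
    then show ?case
      by (rule diff_upto_SucI[OF DERIV_mult[OF diff_upto_DERIV[OF Suc.prems(1)] diff_upto_DERIV[OF Suc.prems(2)]]])
  qed
  then show ?thesis using assms by (auto simp: smooth_def)
qed

section \<open>A smooth bump and the mollified ramp\<close>

definition flat_exp :: "real poly \<Rightarrow> real \<Rightarrow> real" where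
  "flat_exp p t = (if t \<le> 0 then 0 else poly p (1 / t) * exp (- (1 / t)))"

lemma poly_div_exp_tendsto_0: "((\<lambda>x. poly p x / exp x) \<longlongrightarrow> (0::real)) at_top"
proof -
  have "((\<lambda>x. \<Sum>i\<le>degree p. coeff p i * (x ^ i / exp x)) \<longlongrightarrow> (\<Sum>i\<le>degree p. coeff p i * 0)) at_top"
    by (intro tendsto_intros tendsto_power_div_exp_0)
  then show ?thesis
    by (simp add: poly_altdef sum_divide_distrib)
qed

text \<open>The polynomial factor closes the family: differentiating
  \<open>p(1/t) * exp(-1/t)\<close> gives \<open>(p - p')(1/t) / t^2 * exp(-1/t)\<close>. At 0 the
  difference quotient from the right is again a polynomial in 1/h over exp(1/h), which tends to
  0.\<close>

lemma flat_exp_has_derivative: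
  "(flat_exp p has_real_derivative flat_exp ([:0, 0, 1:] * (p - pderiv p)) t) (at t)"
proof -
  consider "t < 0" | "t = 0" | "t > 0" by linarith
  then show ?thesis
  proof cases
    case 1
    have "((\<lambda>_. 0) has_real_derivative 0) (at t)" by simp
    then have "(flat_exp p has_real_derivative 0) (at t)"
      by (rule DERIV_cong_ev[THEN iffD1, rotated 3])
        (use 1 in \<open>auto simp: flat_exp_def intro!: eventually_nhds_in_open[of "{..<0}", THEN eventually_mono]\<close>)
    with 1 show ?thesis by (simp add: flat_exp_def)
  next
    case 2
    have "((\<lambda>h. flat_exp p h / h) \<longlongrightarrow> 0) (at_right 0)"
    proof (rule Lim_transform_eventually)
      show "((\<lambda>h. poly ([:0, 1:] * p) (inverse h) / exp (inverse h)) \<longlongrightarrow> 0) (at_right (0::real))"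
        by (rule filterlim_compose[OF poly_div_exp_tendsto_0 filterlim_inverse_at_top_right])
      show "\<forall>\<^sub>F h in at_right 0. poly ([:0, 1:] * p) (inverse h) / exp (inverse h) = flat_exp p h / h"
        unfolding eventually_at_right_field
        by (intro exI[of _ 1]) (auto simp: flat_exp_def exp_minus field_simps)
    qed
    moreover have "((\<lambda>h. flat_exp p h / h) \<longlongrightarrow> 0) (at_left 0)"
      by (rule Lim_transform_eventually[OF tendsto_const])
        (auto simp: flat_exp_def eventually_at_left_field intro!: exI[of _ "-1"])
    ultimately have "((\<lambda>h. flat_exp p h / h) \<longlongrightarrow> 0) (at 0)"
      by (simp add: filterlim_split_at)
    then show ?thesis using 2 by (simp add: DERIV_def flat_exp_def)
  next
    case 3
    have "((\<lambda>t. poly p (1 / t) * exp (- (1 / t))) has_real_derivative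
        flat_exp ([:0, 0, 1:] * (p - pderiv p)) t) (at t)"
      using 3
      by (auto intro!: derivative_eq_intros DERIV_chain2[OF poly_DERIV]
        simp: flat_exp_def field_simps power2_eq_square)
    then show ?thesis
      by (rule DERIV_cong_ev[THEN iffD1, rotated 3])
        (use 3 in \<open>auto simp: flat_exp_def intro!: eventually_nhds_in_open[of "{0<..}", THEN eventually_mono]\<close>)
  qed
qed

lemma smooth_flat_exp: "smooth (flat_exp p)"
  by (rule smooth_coinduct[of _ "range flat_exp"]) (use flat_exp_has_derivative in blast)+

lemma smooth_has_antiderivative:
  assumes "smooth h"
  obtains F where "smooth F" "\<And>t. (F has_real_derivative h t) (at t)"
proof -
  have "\<exists>F. \<forall>t::real. - \<infinity> < ereal t \<longrightarrow> ereal t < \<infinity> \<longrightarrow> (F has_vector_derivative h t) (at t)"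
  proof (rule einterval_antiderivative)
    show "isCont h t" for t using DERIV_isCont[OF smoothD[OF assms]] .
  qed simp
  then obtain F where "\<And>t. (F has_real_derivative h t) (at t)"
    by (auto simp: has_real_derivative_iff_has_vector_derivative)
  then show ?thesis
    using that smoothI[OF _ assms] by blast
qed

text \<open>A bump on (-e, e), normalised to integral 1 and integrated twice, is a smooth copy of
  \<open>max 0\<close>; its second derivative is a mollifier.\<close>

lemma smooth_ramp_exists:
  assumes "0 < e"
  obtains R where "smooth R" "\<And>t. t \<le> - e \<Longrightarrow> R t = 0"
    "\<And>t. 0 \<le> deriv (deriv R) t" "\<And>t. e \<le> \<bar>t\<bar> \<Longrightarrow> deriv (deriv R) t = 0"
    "\<And>t. deriv R t \<in> {0..1}" "deriv R (- e) = 0" "deriv R e = 1"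
proof -
  \<comment> \<open>Each factor vanishes on one side of the interval (-e, e). The redundant
    coefficients give the arguments the form required by \<open>smooth_affine\<close>.\<close>
  define b where "b t = flat_exp 1 (1 * t + e) * flat_exp 1 ((-1) * t + e)" for t
  have "smooth b"
    unfolding b_def
    using smooth_affine[OF smooth_flat_exp, of 1 1 1 e] smooth_affine[OF smooth_flat_exp, of 1 1 "-1" e]
    by (intro smooth_mult) simp_all
  then obtain F where F: "smooth F" "\<And>t. (F has_real_derivative b t) (at t)"
    using smooth_has_antiderivative by blast
  have b0: "b t \<ge> 0" for t by (simp add: b_def flat_exp_def)
  have bz: "b t = 0" if "e \<le> \<bar>t\<bar>" for t using that by (auto simp: b_def flat_exp_def)
  have bpos: "b t > 0" if "\<bar>t\<bar> < e" for t using that by (auto simp: b_def flat_exp_def)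
  have Fmono: "F s \<le> F t" if "s \<le> t" for s t
    by (rule DERIV_nonneg_imp_nondecreasing[OF that]) (use F b0 in blast)
  define c where "c = F e - F (-e)"
  have "F (-e) < F e"
  proof (rule DERIV_pos_imp_increasing_open[of "- e" e F])
    show "\<exists>y. (F has_real_derivative y) (at t) \<and> 0 < y" if "- e < t" "t < e" for t
      using F(2)[of t] bpos[of t] that by (intro exI[of _ "b t"]) auto
    show "continuous_on {- e..e} F" using smooth_continuous[OF F(1)] .
  qed (use assms in simp)
  then have c: "c > 0" by (simp add: c_def)
  have const: "F t = F s" if "s < t" "\<And>u. s < u \<Longrightarrow> u < t \<Longrightarrow> e \<le> \<bar>u\<bar>" for s t
  proof (rule DERIV_isconst_end[OF that(1)])
    show "continuous_on {s..t} F" using smooth_continuous F(1) by blast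
    show "(F has_real_derivative 0) (at u)" if "s < u" "u < t" for u
      using F(2)[of u] bz[of u] \<open>\<And>u. s < u \<Longrightarrow> u < t \<Longrightarrow> e \<le> \<bar>u\<bar>\<close>[OF that] by simp
  qed
  have left: "F t = F (-e)" if "t \<le> - e" for t
    using that const[of t "-e"] assms by (cases "t = - e") auto
  have right: "F t = F e" if "e \<le> t" for t
    using that const[of e t] assms by (cases "t = e") auto
  define D where "D t = (1 / c) * F (1 * t + 0) + (- F (-e) / c)" for t
  have D: "D t = (F t - F (-e)) / c" for t
    by (simp add: D_def diff_divide_distrib)
  have "smooth D"
    unfolding D_def by (intro smooth_add smooth_affine smooth_const F)
  then obtain G where G: "smooth G" "\<And>t. (G has_real_derivative D t) (at t)"
    using smooth_has_antiderivative by blast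
  define R where "R t = G t + (- G (-e))" for t
  have sR: "smooth R"
    unfolding R_def by (intro smooth_add smooth_const G)
  have RD: "deriv R = D"
    unfolding R_def by (rule ext, rule DERIV_imp_deriv) (auto intro!: derivative_eq_intros G)
  have RDD: "deriv (deriv R) t = b t / c" for t
    unfolding RD D
    by (rule DERIV_imp_deriv) (use c in \<open>auto intro!: derivative_eq_intros F\<close>)
  have D0: "D t = 0" if "t \<le> - e" for t
    by (simp add: D left[OF that])
  have R0: "R t = 0" if "t \<le> - e" for t
  proof (cases "t = - e")
    case False
    have "G (- e) = G t"
    proof (rule DERIV_isconst_end[of t "- e" G])
      show "t < - e" using that False by simp
      show "continuous_on {t..- e} G" using smooth_continuous[OF G(1)] .
      show "(G has_real_derivative 0) (at u)" if "u < - e" for u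
        using G(2)[of u] D0[of u] that by simp
    qed
    then show ?thesis by (simp add: R_def)
  qed (simp add: R_def)
  have Dle: "D t \<in> {0..1}" for t
  proof -
    have "F (-e) \<le> F t" using Fmono[of "-e" t] left[of t] by linarith
    moreover have "F t \<le> F e" using Fmono[of t e] right[of t] by linarith
    ultimately show ?thesis using c by (simp add: D c_def)
  qed
  show ?thesis
  proof (rule that[of R])
    show "0 \<le> deriv (deriv R) t" for t using b0[of t] c by (simp add: RDD)
    show "deriv (deriv R) t = 0" if "e \<le> \<bar>t\<bar>" for t using bz[OF that] by (simp add: RDD)
    show "deriv R t \<in> {0..1}" for t using Dle[of t] by (simp only: RD)
    show "deriv R (- e) = 0" using D0[of "- e"] by (simp only: RD)
    show "deriv R e = 1" using c unfolding RD D c_def by simp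
  qed (use sR R0 in blast)+
qed

subsection \<open>Pairing the second derivative with piecewise affine functions\<close>

lemma sets_total_variation [simp, measurable_cong]: "sets (total_variation \<mu>) = sets borel"
  using sets.sigma_sets_eq[of borel] by (simp add: total_variation_def)

lemma emeasure_total_variation:
  assumes "sets P = sets borel" "sets N = sets borel" "A \<in> sets borel"
  shows "emeasure (total_variation (P, N)) A = emeasure P A + emeasure N A"
proof -
  have "emeasure (total_variation (P, N)) A = emeasure (fst (P, N)) A + emeasure (snd (P, N)) A"
  proof (rule emeasure_measure_of[OF total_variation_def])
    show "countably_additive (sets (total_variation (P, N)))
        (\<lambda>A. emeasure (fst (P, N)) A + emeasure (snd (P, N)) A)"
      by (rule countably_additiveI) (auto simp: assms suminf_add[symmetric] suminf_emeasure)
  qed (use assms in \<open>auto simp: positive_def\<close>)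
  then show ?thesis by simp
qed

lemma nn_integral_total_variation:
  assumes "sets P = sets borel" "sets N = sets borel" "h \<in> borel_measurable borel"
  shows "(\<integral>\<^sup>+ t. h t \<partial>total_variation (P, N)) = (\<integral>\<^sup>+ t. h t \<partial>P) + (\<integral>\<^sup>+ t. h t \<partial>N)"
  using assms(3)
proof (induction h rule: borel_measurable_induct)
  have [measurable_cong]: "sets P = sets borel" "sets N = sets borel" by fact+
  {
    case (cong f g)
    then have "f = g" by (simp add: fun_eq_iff)
    then show ?case using cong by simp
  next
    case (set A)
    then show ?case using assms by (simp add: emeasure_total_variation)
  next
    case (mult u c)
    then show ?case by (simp add: nn_integral_cmult distrib_left)
  next
    case (add u v)
    then show ?case by (simp add: nn_integral_add algebra_simps)
  next
    case (seq U)
    note [measurable] = seq(1)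
    have inc: "incseq (\<lambda>i. \<integral>\<^sup>+ t. U i t \<partial>M)" for M
      using \<open>incseq U\<close> by (auto simp: incseq_def le_fun_def intro!: nn_integral_mono)
    have "(\<integral>\<^sup>+ t. (SUP i. U i) t \<partial>M) = (SUP i. \<integral>\<^sup>+ t. U i t \<partial>M)" if "sets M = sets borel" for M
    proof -
      note [measurable_cong] = that
      show ?thesis
        unfolding SUP_apply by (rule nn_integral_monotone_convergence_SUP[OF \<open>incseq U\<close>]) measurable
    qed
    then show ?case
      using assms(1,2) seq.IH by (simp add: ennreal_SUP_add[OF inc inc])
  }
qed

text \<open>Both parts of a signed Radon measure may have infinite mass; functions of this class are
  integrable for every Radon measure. Measurability replaces continuity because indicators of
  segments will be paired as well.\<close>

definition bounded_support :: "(real \<Rightarrow> real) \<Rightarrow> bool" where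
  "bounded_support h \<longleftrightarrow> h \<in> borel_measurable borel \<and>
     (\<exists>r. \<forall>t. \<bar>h t\<bar> \<le> r \<and> (r < \<bar>t\<bar> \<longrightarrow> h t = 0))"

lemma bounded_supportI:
  assumes "h \<in> borel_measurable borel" "\<And>t. \<bar>h t\<bar> \<le> B" "\<And>t. t \<notin> {a..b} \<Longrightarrow> h t = 0"
  shows "bounded_support h"
  unfolding bounded_support_def
proof (intro conjI exI[of _ "max B (max \<bar>a\<bar> \<bar>b\<bar>)"] allI impI)
  show "h t = 0" if "max B (max \<bar>a\<bar> \<bar>b\<bar>) < \<bar>t\<bar>" for t
  proof -
    have "\<bar>a\<bar> < \<bar>t\<bar>" "\<bar>b\<bar> < \<bar>t\<bar>" using that by simp_all
    then show ?thesis by (intro assms(3)) (unfold atLeastAtMost_iff, linarith)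
  qed
  show "\<bar>h t\<bar> \<le> max B (max \<bar>a\<bar> \<bar>b\<bar>)" for t
    using assms(2)[of t] by simp
qed (rule assms(1))

lemma bounded_support_add:
  assumes "bounded_support h" "bounded_support k"
  shows "bounded_support (\<lambda>t. h t + k t)"
proof -
  obtain r s where r: "\<forall>t. \<bar>h t\<bar> \<le> r \<and> (r < \<bar>t\<bar> \<longrightarrow> h t = 0)"
    and s: "\<forall>t. \<bar>k t\<bar> \<le> s \<and> (s < \<bar>t\<bar> \<longrightarrow> k t = 0)"
    using assms unfolding bounded_support_def by blast
  have nonneg: "0 \<le> r" "0 \<le> s" using r[rule_format, of 0] s[rule_format, of 0] by linarith+
  show ?thesis
  proof (rule bounded_supportI[of _ "r + s" "- (r + s)" "r + s"])
    show "(\<lambda>t. h t + k t) \<in> borel_measurable borel"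
      using assms unfolding bounded_support_def by (intro borel_measurable_add) blast+
    show "\<bar>h t + k t\<bar> \<le> r + s" for t
      using r[rule_format, of t] s[rule_format, of t] by linarith
    show "h t + k t = 0" if "t \<notin> {- (r + s)..r + s}" for t
    proof -
      have "r < \<bar>t\<bar>" "s < \<bar>t\<bar>" using that nonneg by auto
      then show ?thesis using r s by simp
    qed
  qed
qed

lemma bounded_support_cmult:
  assumes "bounded_support h"
  shows "bounded_support (\<lambda>t. c * h t)"
proof -
  obtain r where r: "\<forall>t. \<bar>h t\<bar> \<le> r \<and> (r < \<bar>t\<bar> \<longrightarrow> h t = 0)"
    using assms unfolding bounded_support_def by blast
  show ?thesis
  proof (rule bounded_supportI[of _ "\<bar>c\<bar> * r" "- r" r])
    show "\<bar>c * h t\<bar> \<le> \<bar>c\<bar> * r" for t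
      using r by (simp add: abs_mult mult_left_mono)
    show "c * h t = 0" if "t \<notin> {- r..r}" for t
      using r that by (auto simp: abs_if)
  qed (use assms in \<open>auto simp: bounded_support_def intro!: borel_measurable_times\<close>)
qed

lemma bounded_support_0: "bounded_support (\<lambda>_. 0)"
  by (rule bounded_supportI[of _ 0 0 0]) auto

lemma bounded_support_sum:
  "(\<And>i. i \<in> I \<Longrightarrow> bounded_support (h i)) \<Longrightarrow> bounded_support (\<lambda>t. \<Sum>i\<in>I. h i t)"
  by (induction I rule: infinite_finite_induct)
    (auto intro: bounded_support_0 bounded_support_add)

lemma bounded_support_continuous:
  assumes "continuous_on UNIV h" "\<And>t. t \<notin> {a..b} \<Longrightarrow> h t = 0"
  shows "bounded_support h"
proof -
  have "compact (h ` {a..b})"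
    using assms(1) by (intro compact_continuous_image continuous_on_subset[OF assms(1)]) auto
  then have "bounded (h ` {a..b})" by (rule compact_imp_bounded)
  then obtain B where "\<forall>u \<in> h ` {a..b}. norm u \<le> B"
    unfolding bounded_iff by blast
  then have B: "\<bar>h t\<bar> \<le> B" if "t \<in> {a..b}" for t
    using that by auto
  have "\<bar>h t\<bar> \<le> max B 0" for t
    using B[of t] assms(2)[of t] by (cases "t \<in> {a..b}") auto
  then show ?thesis
    using assms by (intro bounded_supportI[of h "max B 0" a b] borel_measurable_continuous_onI)
qed

lemma radon_measureD:
  assumes "radon_measure M"
  shows "sets M = sets borel" "emeasure M {a..b} < \<infinity>"
  using assms unfolding radon_measure_def by auto

lemma radon_integrable:
  assumes "radon_measure M" "bounded_support h"
  shows "integrable M h"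
proof -
  obtain r where r: "\<forall>t. \<bar>h t\<bar> \<le> r \<and> (r < \<bar>t\<bar> \<longrightarrow> h t = 0)"
    using assms unfolding bounded_support_def by blast
  note M = radon_measureD[OF assms(1)]
  have "\<bar>h t\<bar> \<le> \<bar>r * indicator {-r..r} t\<bar>" for t
  proof (cases "t \<in> {-r..r}")
    case True
    then show ?thesis using r by (simp add: order_trans[OF _ abs_ge_self])
  next
    case False
    then have "r < \<bar>t\<bar>" by auto
    then show ?thesis using r by simp
  qed
  moreover have "h \<in> borel_measurable M"
    using assms(2) unfolding bounded_support_def measurable_cong_sets[OF M(1) refl] by blast
  moreover have "integrable M (\<lambda>t. r * indicator {-r..r} t)"
    using M by (intro integrable_mult_right integrable_real_indicator) auto
  ultimately show ?thesis
    by (intro Bochner_Integration.integrable_bound[of M "\<lambda>t. r * indicator {-r..r} t" h]) auto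
qed

lemma radon_integral_bound:
  assumes "radon_measure M" "bounded_support h" "\<And>t. \<bar>h t\<bar> \<le> B * indicator {a..b} t"
  shows "\<bar>LINT t|M. h t\<bar> \<le> B * measure M {a..b}"
proof -
  have "\<bar>LINT t|M. h t\<bar> \<le> (LINT t|M. B * indicator {a..b} t)"
    using radon_integrable[OF assms(1,2)] radon_measureD[OF assms(1)] assms(3)
    by (intro integral_abs_bound_integral) auto
  then show ?thesis using radon_measureD(1)[OF assms(1)] by simp
qed

lemma radon_lborel: "radon_measure lborel"
  using emeasure_bounded_finite compact_imp_bounded by (auto simp: radon_measure_def)

lemma signed_radonD:
  assumes "signed_radon_measure \<mu>"
  shows "radon_measure (fst \<mu>)" "radon_measure (snd \<mu>)"
  using assms by (auto simp: signed_radon_measure_def)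

lemma signed_integral_add:
  assumes "signed_radon_measure \<mu>" "bounded_support h" "bounded_support k"
  shows "signed_integral \<mu> (\<lambda>t. h t + k t) = signed_integral \<mu> h + signed_integral \<mu> k"
  using signed_radonD[OF assms(1)] assms(2,3)
  by (simp add: signed_integral_def radon_integrable)

lemma signed_integral_cmult: "signed_integral \<mu> (\<lambda>t. c * h t) = c * signed_integral \<mu> h"
  by (simp add: signed_integral_def right_diff_distrib)

lemma signed_integral_sum:
  assumes "signed_radon_measure \<mu>" "\<And>i. i \<in> I \<Longrightarrow> bounded_support (h i)"
  shows "signed_integral \<mu> (\<lambda>t. \<Sum>i\<in>I. h i t) = (\<Sum>i\<in>I. signed_integral \<mu> (h i))"
  using assms(2)
  by (induction I rule: infinite_finite_induct)
    (auto simp: signed_integral_add[OF assms(1)] bounded_support_sum, auto simp: signed_integral_def)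

lemma signed_integral_bound:
  assumes "signed_radon_measure \<mu>" "bounded_support h" "\<And>t. \<bar>h t\<bar> \<le> B * indicator {a..b} t"
  shows "\<bar>signed_integral \<mu> h\<bar> \<le> B * (measure (fst \<mu>) {a..b} + measure (snd \<mu>) {a..b})"
  using radon_integral_bound[OF signed_radonD(1)[OF assms(1)] assms(2,3)]
    radon_integral_bound[OF signed_radonD(2)[OF assms(1)] assms(2,3)]
  by (simp add: signed_integral_def distrib_left abs_le_iff)

section \<open>Compactly supported combinations of ramps\<close>

lemma ramp_sum_support:
  fixes R :: "real \<Rightarrow> real"
  assumes "\<And>t. t \<le> - e \<Longrightarrow> R t = 0" "\<And>t. e \<le> t \<Longrightarrow> R t = t + k"
    and "(\<Sum>j\<in>J. c j) = 0" "(\<Sum>j\<in>J. c j * p j) = 0" "\<And>j. j \<in> J \<Longrightarrow> p j \<in> {a..b}"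
    and "t \<notin> {a - e..b + e}"
  shows "(\<Sum>j\<in>J. c j * R (t - p j)) = 0"
proof (cases "t < a - e")
  case True
  then have "R (t - p j) = 0" if "j \<in> J" for j
    using assms(5)[OF that] by (intro assms(1)) simp
  then show ?thesis by simp
next
  case False
  \<comment> \<open>To the right of all knots every ramp is affine, and the two conditions on
    \<open>c\<close> annihilate affine functions. The offset \<open>k\<close> is 0 for
    \<open>max 0\<close> and \<open>R e - e\<close> for the mollified ramp.\<close>
  then have eq: "R (t - p j) = t - p j + k" if "j \<in> J" for j
    using assms(6) assms(5)[OF that] by (intro assms(2)) auto
  have "c j * R (t - p j) = (t + k) * c j - c j * p j" if "j \<in> J" for j
    unfolding eq[OF that] by algebra
  then have "(\<Sum>j\<in>J. c j * R (t - p j)) = (\<Sum>j\<in>J. (t + k) * c j - c j * p j)"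
    by (rule sum.cong[OF refl])
  also have "\<dots> = 0"
    using assms(3,4) by (simp add: sum_subtractf sum_distrib_left[symmetric])
  finally show ?thesis .
qed

lemma ramp_sum_eq_0:
  fixes c p :: "'a \<Rightarrow> real"
  assumes "(\<Sum>j\<in>J. c j) = 0" "(\<Sum>j\<in>J. c j * p j) = 0" "\<And>j. j \<in> J \<Longrightarrow> p j \<in> {a..b}"
    and "t \<notin> {a..b}"
  shows "(\<Sum>j\<in>J. c j * max 0 (t - p j)) = 0"
  by (rule ramp_sum_support[where R = "max 0" and e = 0 and k = 0 and a = a and b = b])
    (use assms in auto)

lemma bounded_support_ramp_sum:
  assumes "(\<Sum>j\<in>J. c j) = 0" "(\<Sum>j\<in>J. c j * p j) = 0" "\<And>j. j \<in> J \<Longrightarrow> p j \<in> {a..b}"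
  shows "bounded_support (\<lambda>t. \<Sum>j\<in>J. c j * max 0 (t - p j))"
  by (rule bounded_support_continuous[of _ a b])
    (use ramp_sum_eq_0[OF assms] in \<open>auto intro!: continuous_intros\<close>)

text \<open>The density \<rho> has mass 1 on [-e, e], expressed through its antiderivative
  \<open>D\<close>. Averaging an \<open>L\<close>-Lipschitz function over distances up to
  \<open>e\<close> changes it by at most \<open>L * e\<close>.\<close>

lemma lipschitz_mollification:
  assumes "L-lipschitz_on UNIV f" "continuous_on UNIV \<rho>" "\<And>t. 0 \<le> \<rho> t" "\<And>t. e \<le> \<bar>t\<bar> \<Longrightarrow> \<rho> t = 0"
    and "\<And>t. (D has_real_derivative \<rho> t) (at t)" "D e - D (- e) = 1" "0 < e"
  shows "bounded_support (\<lambda>t. f t * \<rho> (t - p))" "\<bar>(LINT t|lborel. f t * \<rho> (t - p)) - f p\<bar> \<le> L * e"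
proof -
  have f: "continuous_on UNIV f" using assms(1) by (rule lipschitz_on_continuous_on)
  have shift: "continuous_on UNIV (\<lambda>t. \<rho> (t - p))"
    by (intro continuous_on_compose2[OF assms(2)] continuous_intros) auto
  have zero: "\<rho> (t - p) = 0" if "t \<notin> {p - e..p + e}" for t
    using that by (intro assms(4)) (auto simp: abs_if)
  show bs: "bounded_support (\<lambda>t. f t * \<rho> (t - p))"
    using zero by (intro bounded_support_continuous[of _ "p - e" "p + e"] continuous_intros f shift) auto
  have bs1: "bounded_support (\<lambda>t. \<rho> (t - p))"
    using zero by (intro bounded_support_continuous[of _ "p - e" "p + e"] shift) auto
  note int = radon_integrable[OF radon_lborel]
  have "\<rho> (t - p) = \<rho> (t - p) * indicator {p - e..p + e} t" for t
    using zero[of t] by (cases "t \<in> {p - e..p + e}") auto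
  then have "(LINT t|lborel. \<rho> (t - p)) = (LINT t|lborel. \<rho> (t - p) * indicator {p - e..p + e} t)"
    by (rule Bochner_Integration.integral_cong[OF refl])
  also have "\<dots> = D (p + e - p) - D (p - e - p)"
  proof (rule integral_FTC_Icc_real)
    show "((\<lambda>t. D (t - p)) has_real_derivative \<rho> (t - p)) (at t)" for t
      using DERIV_shift[of D "\<rho> (t - p)" t "- p"] assms(5) by simp
    show "isCont (\<lambda>t. \<rho> (t - p)) t" for t
      using shift by (simp add: continuous_on_eq_continuous_at)
  qed (use assms in simp)
  finally have one: "(LINT t|lborel. \<rho> (t - p)) = 1" using assms(6) by simp
  have "(LINT t|lborel. f t * \<rho> (t - p)) - f p = (LINT t|lborel. f t * \<rho> (t - p) - f p * \<rho> (t - p))"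
    using int[OF bs] int[OF bs1] one by simp
  also have "\<bar>\<dots>\<bar> \<le> (LINT t|lborel. (L * e) * \<rho> (t - p))"
  proof (rule integral_abs_bound_integral)
    show "\<bar>f t * \<rho> (t - p) - f p * \<rho> (t - p)\<bar> \<le> L * e * \<rho> (t - p)" for t
    proof (cases "t \<in> {p - e..p + e}")
      case True
      have "\<bar>f t - f p\<bar> \<le> L * \<bar>t - p\<bar>"
        using lipschitz_onD[OF assms(1), of t p] by (simp add: dist_real_def)
      also have "\<dots> \<le> L * e"
        using True lipschitz_on_nonneg[OF assms(1)] by (intro mult_left_mono) auto
      finally have "\<bar>f t - f p\<bar> * \<rho> (t - p) \<le> L * e * \<rho> (t - p)"
        by (rule mult_right_mono) (rule assms(3))
      then show ?thesis
        using assms(3)[of "t - p"] by (simp add: left_diff_distrib[symmetric] abs_mult)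
    qed (simp add: zero)
  qed (use int[OF bs] int[OF bs1] in simp_all)
  also have "\<dots> = L * e" using one by simp
  finally show "\<bar>(LINT t|lborel. f t * \<rho> (t - p)) - f p\<bar> \<le> L * e" .
qed

text \<open>The condition on test functions extends to continuous piecewise affine functions of compact
  support by replacing \<open>max 0\<close> with a mollified ramp.\<close>

lemma second_distr_deriv_ramp_sum:
  assumes f: "L-lipschitz_on UNIV f" and \<mu>: "second_distr_deriv f \<mu>"
    and J: "(\<Sum>j\<in>J. c j) = 0" "(\<Sum>j\<in>J. c j * p j) = 0" "\<And>j. j \<in> J \<Longrightarrow> p j \<in> {a..b}"
  shows "signed_integral \<mu> (\<lambda>t. \<Sum>j\<in>J. c j * max 0 (t - p j)) = (\<Sum>j\<in>J. c j * f (p j))"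
proof -
  have sr: "signed_radon_measure \<mu>" using \<mu> by (simp add: second_distr_deriv_def)
  define \<phi> where "\<phi> t = (\<Sum>j\<in>J. c j * max 0 (t - p j))" for t
  have bs: "bounded_support \<phi>"
    unfolding \<phi>_def by (rule bounded_support_ramp_sum[OF J])
  define S where "S = (\<Sum>j\<in>J. \<bar>c j\<bar>)"
  define m where "m = measure (fst \<mu>) {a - 1..b + 1} + measure (snd \<mu>) {a - 1..b + 1}"
  have "0 \<le> S" by (simp add: S_def sum_nonneg)
  \<comment> \<open>There are two errors. Replacing \<open>max 0\<close> by \<open>R\<close> costs
    at most \<open>2 * e\<close> per ramp, on a fixed interval of finite mass \<open>m\<close>;
    replacing \<open>f (p j)\<close> by its average against the second derivative of
    \<open>R\<close> costs \<open>L * e\<close>. The restriction \<open>e \<le> 1\<close> keeps all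
    supports in [a - 1, b + 1].\<close>
  have bound: "\<bar>signed_integral \<mu> \<phi> - (\<Sum>j\<in>J. c j * f (p j))\<bar> \<le> (2 * S * m + S * L) * e"
    if e: "0 < e" "e \<le> 1" for e
  proof -
    obtain R where R: "smooth R" "\<And>t. t \<le> - e \<Longrightarrow> R t = 0"
      "\<And>t. 0 \<le> deriv (deriv R) t" "\<And>t. e \<le> \<bar>t\<bar> \<Longrightarrow> deriv (deriv R) t = 0"
      "\<And>t. deriv R t \<in> {0..1}" "deriv R (- e) = 0" "deriv R e = 1"
      using smooth_ramp_exists[OF e(1)] by blast
    note DR = smoothD[OF R(1)] and DDR = smoothD[OF smooth_deriv[OF R(1)]]
    have right: "R t = t + (R e - e)" if "e \<le> t" for t
    proof (cases "t = e")
      case False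
      have "deriv R u = 1" if "e \<le> u" for u
      proof (cases "u = e")
        case False
        have "deriv R u = deriv R e"
        proof (rule DERIV_isconst_end[of e u "deriv R"])
          show "continuous_on {e..u} (deriv R)" by (rule smooth_continuous[OF smooth_deriv[OF R(1)]])
          show "(deriv R has_real_derivative 0) (at v)" if "e < v" for v
            using DDR[of v] R(4)[of v] that e by simp
        qed (use that False in simp)
        then show ?thesis using R(7) by simp
      qed (simp add: R(7))
      then have "R t - t = R e - e"
      proof (intro DERIV_isconst_end[of e t "\<lambda>t. R t - t"])
        show "continuous_on {e..t} (\<lambda>t. R t - t)"
          by (intro continuous_intros smooth_continuous R(1))
        show "((\<lambda>t. R t - t) has_real_derivative 0) (at v)"
          if "e < v" "\<And>u. e \<le> u \<Longrightarrow> deriv R u = 1" for v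
          using DERIV_diff[OF DR DERIV_ident, of v] that by simp
      qed (use that False in simp)
      then show ?thesis by simp
    qed simp
    have mono: "R s \<le> R t" if "s \<le> t" for s t
    proof (rule DERIV_nonneg_imp_nondecreasing[OF that])
      show "\<exists>y. (R has_real_derivative y) (at u) \<and> 0 \<le> y" for u
        using DR[of u] R(5)[of u] by auto
    qed
    have lip: "R t - R s \<le> t - s" if "s \<le> t" for s t
    proof -
      have "(\<lambda>t. t - R t) s \<le> (\<lambda>t. t - R t) t"
      proof (rule DERIV_nonneg_imp_nondecreasing[OF that])
        show "\<exists>y. ((\<lambda>t. t - R t) has_real_derivative y) (at u) \<and> 0 \<le> y" for u
          using DERIV_diff[OF DERIV_ident DR, of u] R(5)[of u] by auto
      qed
      then show ?thesis by simp
    qed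
    have close: "\<bar>R t - max 0 t\<bar> \<le> 2 * e" for t
    proof -
      \<comment> \<open>\<open>R\<close> vanishes at -e and its slope lies between 0 and 1.\<close>
      have "0 \<le> R e" "R e \<le> 2 * e" using mono[of "-e" e] lip[of "-e" e] R(2)[of "-e"] e by auto
      consider "t \<le> - e" | "- e < t" "t < e" | "e \<le> t" by linarith
      then show ?thesis
      proof cases
        case 1
        then show ?thesis using R(2)[OF 1] e by simp
      next
        case 2
        then have "0 \<le> R t" "R t \<le> 2 * e" using mono[of "-e" t] lip[of "-e" t] R(2)[of "-e"] by auto
        then show ?thesis using 2 e by auto
      next
        case 3
        then show ?thesis using right[OF 3] \<open>0 \<le> R e\<close> \<open>R e \<le> 2 * e\<close> e by auto
      qed
    qed
    define \<psi> where "\<psi> t = (\<Sum>j\<in>J. c j * R (1 * t + (- p j)))" for t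
    have \<psi>: "\<psi> t = (\<Sum>j\<in>J. c j * R (t - p j))" for t by (simp add: \<psi>_def)
    have smooth: "smooth \<psi>"
      unfolding \<psi>_def by (intro smooth_sum smooth_affine R(1))
    have d: "((\<lambda>t. \<Sum>j\<in>J. c j * h (t - p j)) has_real_derivative (\<Sum>j\<in>J. c j * h' (t - p j))) (at t)"
      if "\<And>t. (h has_real_derivative h' t) (at t)" for h h' t
    proof (intro DERIV_sum DERIV_cmult)
      show "((\<lambda>t. h (t - p j)) has_real_derivative h' (t - p j)) (at t)" for j
        using DERIV_shift[of h "h' (t - p j)" t "- p j"] that by simp
    qed
    have "deriv \<psi> = (\<lambda>t. \<Sum>j\<in>J. c j * deriv R (t - p j))"
      unfolding \<psi>[abs_def] by (rule ext, rule DERIV_imp_deriv, rule d, rule DR)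
    then have deriv2: "(deriv ^^ 2) \<psi> = (\<lambda>t. \<Sum>j\<in>J. c j * deriv (deriv R) (t - p j))"
      using DERIV_imp_deriv[OF d[OF DDR]] by (auto simp: numeral_2_eq_2)
    have supp: "\<psi> t = 0" if "t \<notin> {a - 1..b + 1}" for t
      unfolding \<psi> using J that e by (intro ramp_sum_support[where e = e and k = "R e - e" and a = a and b = b] R(2) right) auto
    have "test_function \<psi>"
    proof -
      have "{t. \<psi> t \<noteq> 0} \<subseteq> {a - 1..b + 1}" using supp by blast
      then have "closure {t. \<psi> t \<noteq> 0} \<subseteq> {a - 1..b + 1}" by (intro closure_minimal) auto
      then have "bounded (closure {t. \<psi> t \<noteq> 0})" using bounded_subset[OF bounded_closed_interval] by auto
      then show ?thesis using smooth by (simp add: test_function_iff compact_eq_bounded_closed)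
    qed
    then have "signed_integral \<mu> \<psi> = (LINT t|lborel. f t * (deriv ^^ 2) \<psi> t)"
      using \<mu> by (simp add: second_distr_deriv_def)
    also have "\<dots> = (LINT t|lborel. (\<Sum>j\<in>J. c j * (f t * deriv (deriv R) (t - p j))))"
      by (simp add: deriv2 sum_distrib_left algebra_simps)
    also have "\<dots> = (\<Sum>j\<in>J. c j * (LINT t|lborel. f t * deriv (deriv R) (t - p j)))"
    proof -
      have "integrable lborel (\<lambda>t. f t * deriv (deriv R) (t - p j))" for j
        by (rule radon_integrable[OF radon_lborel lipschitz_mollification(1)[OF f _ R(3) R(4) DDR]])
          (use R e in \<open>auto intro: smooth_continuous smooth_deriv\<close>)
      then show ?thesis by (subst Bochner_Integration.integral_sum) auto
    qed
    finally have "\<bar>signed_integral \<mu> \<psi> - (\<Sum>j\<in>J. c j * f (p j))\<bar> =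
        \<bar>\<Sum>j\<in>J. c j * ((LINT t|lborel. f t * deriv (deriv R) (t - p j)) - f (p j))\<bar>"
      by (simp add: right_diff_distrib sum_subtractf)
    also have "\<dots> \<le> (\<Sum>j\<in>J. \<bar>c j\<bar> * (L * e))"
    proof (intro order_trans[OF sum_abs] sum_mono)
      fix j
      have "\<bar>(LINT t|lborel. f t * deriv (deriv R) (t - p j)) - f (p j)\<bar> \<le> L * e"
        by (rule lipschitz_mollification(2)[OF f _ R(3) R(4) DDR])
          (use R e in \<open>auto intro: smooth_continuous smooth_deriv\<close>)
      then show "\<bar>c j * ((LINT t|lborel. f t * deriv (deriv R) (t - p j)) - f (p j))\<bar> \<le> \<bar>c j\<bar> * (L * e)"
        by (simp add: abs_mult mult_left_mono)
    qed
    also have "\<dots> = S * L * e" by (simp add: S_def sum_distrib_right mult.assoc)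
    finally have 1: "\<bar>signed_integral \<mu> \<psi> - (\<Sum>j\<in>J. c j * f (p j))\<bar> \<le> S * L * e" .
    have bs\<psi>: "bounded_support \<psi>"
      using supp by (intro bounded_support_continuous[OF smooth_continuous[OF smooth]])
    have "signed_integral \<mu> \<phi> - signed_integral \<mu> \<psi> = signed_integral \<mu> (\<lambda>t. \<phi> t + (-1) * \<psi> t)"
      by (subst signed_integral_add[OF sr bs bounded_support_cmult[OF bs\<psi>]])
        (simp only: signed_integral_cmult)
    also have "\<bar>\<dots>\<bar> \<le> (2 * S * e) * m"
      unfolding m_def
    proof (rule signed_integral_bound[OF sr])
      show "bounded_support (\<lambda>t. \<phi> t + (-1) * \<psi> t)"
        by (intro bounded_support_add bounded_support_cmult bs bs\<psi>)
      show "\<bar>\<phi> t + (-1) * \<psi> t\<bar> \<le> 2 * S * e * indicator {a - 1..b + 1} t" for t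
      proof (cases "t \<in> {a - 1..b + 1}")
        case True
        have "\<bar>\<phi> t + (-1) * \<psi> t\<bar> = \<bar>\<Sum>j\<in>J. c j * (max 0 (t - p j) - R (t - p j))\<bar>"
          by (simp add: \<phi>_def \<psi> right_diff_distrib sum_subtractf)
        also have "\<dots> \<le> (\<Sum>j\<in>J. \<bar>c j\<bar> * (2 * e))"
          using close abs_minus_commute
          by (intro order_trans[OF sum_abs] sum_mono) (simp add: abs_mult mult_left_mono abs_minus_commute)
        also have "\<dots> = 2 * S * e" by (simp add: S_def sum_distrib_left sum_distrib_right mult_ac)
        finally show ?thesis using True by simp
      next
        case False
        have "\<phi> t = 0"
          unfolding \<phi>_def by (rule ramp_sum_eq_0[OF J]) (use False in auto)
        then show ?thesis using supp[OF False] False by simp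
      qed
    qed
    finally show ?thesis using 1 by (simp add: algebra_simps abs_le_iff)
  qed
  have "\<bar>signed_integral \<mu> \<phi> - (\<Sum>j\<in>J. c j * f (p j))\<bar> \<le> 0"
  proof (rule tendsto_lowerbound)
    show "((\<lambda>e. (2 * S * m + S * L) * e) \<longlongrightarrow> 0) (at_right 0)"
      by (rule tendsto_eq_intros refl | simp)+
    show "\<forall>\<^sub>F e in at_right 0. \<bar>signed_integral \<mu> \<phi> - (\<Sum>j\<in>J. c j * f (p j))\<bar> \<le> (2 * S * m + S * L) * e"
      unfolding eventually_at_right_field by (rule exI[of _ 1]) (auto intro!: bound)
  qed simp
  then show ?thesis unfolding \<phi>_def by simp
qed

subsection \<open>Uniqueness of the second derivative\<close>

text \<open>For small \<open>h\<close> this rises linearly from 0 to 1 on [a, a + h] and falls back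
  on [b - h, b]. It tends pointwise to the indicator of the open interval, and being a sum of ramps
  it pairs with the second derivative to a finite difference of \<open>f\<close>.\<close>

definition trapezoid :: "real \<Rightarrow> real \<Rightarrow> real \<Rightarrow> real \<Rightarrow> real" where
  "trapezoid a b h t =
     (max 0 (t - a) - max 0 (t - (a + h)) - max 0 (t - (b - h)) + max 0 (t - b)) / h"

lemma trapezoid_bounds:
  assumes "0 < h" "h \<le> (b - a) / 2"
  shows "\<bar>trapezoid a b h t\<bar> \<le> indicator {a<..<b} t"
    and "a + h \<le> t \<Longrightarrow> t \<le> b - h \<Longrightarrow> trapezoid a b h t = 1"
proof -
  let ?s = "max 0 (t - a) - max 0 (t - (a + h)) - max 0 (t - (b - h)) + max 0 (t - b)"
  have "0 \<le> ?s" "?s \<le> h" using assms by (auto simp: max_def)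
  then have "\<bar>?s / h\<bar> \<le> 1" using assms(1) by simp
  moreover have "?s = 0" if "t \<notin> {a<..<b}"
    using that assms by (auto simp: max_def)
  ultimately show "\<bar>trapezoid a b h t\<bar> \<le> indicator {a<..<b} t"
    by (cases "t \<in> {a<..<b}") (simp_all add: trapezoid_def)
  show "trapezoid a b h t = 1" if "a + h \<le> t" "t \<le> b - h"
    using that assms by (simp add: trapezoid_def max_def)
qed

lemma trapezoid_measurable: "trapezoid a b h \<in> borel_measurable borel"
  unfolding trapezoid_def[abs_def] by measurable

lemma trapezoid_integral_tendsto:
  assumes "radon_measure M" "\<And>k. 0 < h k" "\<And>k. h k \<le> (b - a) / 2" "h \<longlonglongrightarrow> 0"
  shows "(\<lambda>k. LINT t|M. trapezoid a b (h k) t) \<longlonglongrightarrow> measure M {a<..<b}"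
proof -
  note M = radon_measureD[OF assms(1)]
  have meas: "g \<in> borel_measurable borel \<Longrightarrow> g \<in> borel_measurable M" for g :: "real \<Rightarrow> real"
    unfolding measurable_cong_sets[OF M(1) refl] .
  have fin: "emeasure M {a<..<b} < \<infinity>"
    by (rule le_less_trans[OF emeasure_mono M(2)[of a b]]) (auto simp: M(1))
  have "(\<lambda>k. LINT t|M. trapezoid a b (h k) t) \<longlonglongrightarrow> (LINT t|M. indicator {a<..<b} t)"
  proof (rule integral_dominated_convergence[where w = "indicator {a<..<b}"])
    show "AE t in M. (\<lambda>k. trapezoid a b (h k) t) \<longlonglongrightarrow> indicator {a<..<b} t"
    proof (rule AE_I2)
      fix t
      show "(\<lambda>k. trapezoid a b (h k) t) \<longlonglongrightarrow> indicator {a<..<b} t"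
      proof (cases "t \<in> {a<..<b}")
        case True
        then have "\<forall>\<^sub>F k in sequentially. h k < min (t - a) (b - t)"
          using assms(4) by (intro order_tendstoD(2)) auto
        then have "\<forall>\<^sub>F k in sequentially. indicator {a<..<b} t = trapezoid a b (h k) t"
          by (rule eventually_mono) (use True trapezoid_bounds(2)[OF assms(2,3)] in auto)
        then show ?thesis by (rule Lim_transform_eventually[OF tendsto_const])
      next
        case False
        have "trapezoid a b (h k) t = 0" for k
          using trapezoid_bounds(1)[OF assms(2,3)[of k], of t] False by simp
        then show ?thesis using False by simp
      qed
    qed
    show "integrable M (indicator {a<..<b} :: real \<Rightarrow> real)"
      using fin M(1) by (intro integrable_real_indicator) auto
    show "AE t in M. norm (trapezoid a b (h k) t) \<le> indicator {a<..<b} t" for k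
      using trapezoid_bounds(1)[OF assms(2,3)] by simp
  qed (auto intro!: meas trapezoid_measurable simp: M(1))
  then show ?thesis using M(1) by simp
qed

text \<open>The left side involves \<open>f\<close> alone, so the signed masses of open intervals do
  not depend on the choice of \<mu>.\<close>

lemma second_distr_deriv_interval:
  assumes f: "L-lipschitz_on UNIV f" and \<mu>: "second_distr_deriv f \<mu>"
    and h: "\<And>k. 0 < h k" "\<And>k. h k \<le> (b - a) / 2" "h \<longlonglongrightarrow> 0"
  shows "(\<lambda>k. (f a - f (a + h k) - f (b - h k) + f b) / h k)
    \<longlonglongrightarrow> measure (fst \<mu>) {a<..<b} - measure (snd \<mu>) {a<..<b}"
proof -
  have sr: "signed_radon_measure \<mu>" using \<mu> by (simp add: second_distr_deriv_def)
  have "signed_integral \<mu> (trapezoid a b (h k)) = (f a - f (a + h k) - f (b - h k) + f b) / h k" for k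
  proof -
    define c :: "nat \<Rightarrow> real" where "c j = (if j = 0 \<or> j = 3 then 1 / h k else - 1 / h k)" for j
    define p :: "nat \<Rightarrow> real" where
      "p j = (if j = 0 then a else if j = 1 then a + h k else if j = 2 then b - h k else b)" for j
    have "trapezoid a b (h k) = (\<lambda>t. \<Sum>j\<in>{0, 1, 2, 3}. c j * max 0 (t - p j))"
      by (simp add: trapezoid_def fun_eq_iff c_def p_def add_divide_distrib diff_divide_distrib)
    moreover have "signed_integral \<mu> (\<lambda>t. \<Sum>j\<in>{0, 1, 2, 3}. c j * max 0 (t - p j)) =
        (\<Sum>j\<in>{0, 1, 2, 3}. c j * f (p j))"
    proof (rule second_distr_deriv_ramp_sum[OF f \<mu>])
      show "p j \<in> {a..b}" for j
        using h(1,2)[of k] by (auto simp: p_def)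
      show "(\<Sum>j\<in>{0, 1, 2, 3}. c j * p j) = 0"
        using h(1)[of k] by (simp add: c_def p_def field_simps)
    qed (simp add: c_def)
    ultimately show ?thesis
      by (simp add: c_def p_def add_divide_distrib diff_divide_distrib)
  qed
  then show ?thesis
    using tendsto_diff[OF trapezoid_integral_tendsto[OF signed_radonD(1)[OF sr] h]
        trapezoid_integral_tendsto[OF signed_radonD(2)[OF sr] h]]
    by (simp add: signed_integral_def)
qed

lemma borel_measure_eqI_intervals:
  fixes M N :: "real measure"
  assumes "sets M = sets borel" "sets N = sets borel"
    and "\<And>a b. a < b \<Longrightarrow> emeasure M {a<..<b} = emeasure N {a<..<b}"
    and "\<And>a b. emeasure M {a<..<b} < \<infinity>"
  shows "M = N"
proof -
  let ?E = "range (\<lambda>(a, b). {a<..<b::real})"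
  show ?thesis
  proof (rule measure_eqI_generator_eq[where E = ?E and \<Omega> = UNIV and A = "\<lambda>i::nat. {- real i<..<real i}"])
    show "Int_stable ?E"
    proof (rule Int_stableI)
      fix A B assume "A \<in> ?E" "B \<in> ?E"
      then obtain a b c d where "A = {a<..<b}" "B = {c<..<d}" by auto
      then have "A \<inter> B = {max a c<..<min b d}" by auto
      then show "A \<inter> B \<in> ?E" by auto
    qed
    have "borel = sigma UNIV ?E"
      using borel_eq_box[where 'a = real] by (simp add: box_real)
    then have "sets borel = sigma_sets UNIV ?E"
      by (metis sets_measure_of subset_UNIV Pow_UNIV)
    then show "sets M = sigma_sets UNIV ?E" "sets N = sigma_sets UNIV ?E"
      using assms(1,2) by simp_all
    show "(\<Union>i::nat. {- real i<..<real i}) = UNIV"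
    proof (intro set_eqI iffI UNIV_I UN_iff[THEN iffD2])
      fix t :: real
      obtain k :: nat where "\<bar>t\<bar> < real k" using reals_Archimedean2 by blast
      then show "\<exists>i\<in>UNIV. t \<in> {- real i<..<real i}" by (intro bexI[of _ k]) auto
    qed
    show "emeasure M X = emeasure N X" if X: "X \<in> ?E" for X
    proof -
      obtain a b where X: "X = {a<..<b}" using X by auto
      show ?thesis
        using assms(3)[of a b] by (cases "a < b") (simp_all add: X)
    qed
  qed (use assms(4) in \<open>auto simp: less_top[symmetric]\<close>)
qed

text \<open>\<open>P\<close> lives on \<open>A\<close>, where \<open>N\<close> vanishes. On
  \<open>E \<inter> A\<close> the equation therefore reads P + N' = P', whence P is at most
  P'.\<close>

lemma jordan_parts_le:
  assumes sets: "sets P = sets borel" "sets N = sets borel" "sets P' = sets borel" "sets N' = sets borel"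
    and A: "A \<in> sets borel" "emeasure P (- A) = 0" "emeasure N A = 0"
    and eq: "\<And>E. E \<in> sets borel \<Longrightarrow> emeasure P E + emeasure N' E = emeasure P' E + emeasure N E"
    and E: "E \<in> sets borel"
  shows "emeasure P E \<le> emeasure P' E"
proof -
  have "emeasure P E \<le> emeasure P (E \<inter> A) + emeasure P (- A)"
  proof -
    have "emeasure P E \<le> emeasure P ((E \<inter> A) \<union> - A)"
      using sets A E by (intro emeasure_mono) auto
    also have "\<dots> \<le> emeasure P (E \<inter> A) + emeasure P (- A)"
      using sets A E by (intro emeasure_subadditive) auto
    finally show ?thesis .
  qed
  also have "\<dots> = emeasure P (E \<inter> A)" using A by simp
  also have "\<dots> \<le> emeasure P (E \<inter> A) + emeasure N' (E \<inter> A)" by simp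
  also have "\<dots> = emeasure P' (E \<inter> A) + emeasure N (E \<inter> A)"
    using A E by (intro eq) auto
  also have "emeasure N (E \<inter> A) = 0"
  proof -
    have "emeasure N (E \<inter> A) \<le> emeasure N A" using sets A E by (intro emeasure_mono) auto
    then show ?thesis using A by simp
  qed
  also have "emeasure P' (E \<inter> A) + 0 \<le> emeasure P' E"
    using sets A E by (auto intro: emeasure_mono)
  finally show ?thesis .
qed

lemma radon_interval_finite:
  assumes "radon_measure M"
  shows "emeasure M {a<..<b} = ennreal (measure M {a<..<b})"
proof (rule emeasure_eq_ennreal_measure)
  have "emeasure M {a<..<b} \<le> emeasure M {a..b}"
    using radon_measureD(1)[OF assms] by (intro emeasure_mono) auto
  then show "emeasure M {a<..<b} \<noteq> top"
    using radon_measureD(2)[OF assms, of a b] by auto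
qed

lemma second_distr_deriv_unique:
  assumes f: "L-lipschitz_on UNIV f" and \<mu>: "second_distr_deriv f \<mu>" "second_distr_deriv f \<nu>"
  shows "\<mu> = \<nu>"
proof -
  obtain P N P' N' where PN: "\<mu> = (P, N)" "\<nu> = (P', N')" by fastforce
  have sr: "signed_radon_measure (P, N)" "signed_radon_measure (P', N')"
    using \<mu> by (auto simp: second_distr_deriv_def PN)
  then have rm: "radon_measure P" "radon_measure N" "radon_measure P'" "radon_measure N'"
    by (auto dest: signed_radonD)
  note sets = rm[THEN radon_measureD(1)]
  \<comment> \<open>P - N may be infinity minus infinity on unbounded sets, so P - N = P' - N' is
    rearranged into an equation of sums. \<open>total_variation\<close> serves as the sum of two
    measures here; the pair \<open>(P, N')\<close> need not be mutually singular.\<close>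
  have tv: "total_variation (P, N') = total_variation (P', N)"
  proof (rule borel_measure_eqI_intervals)
    fix a b :: real
    show "emeasure (total_variation (P, N')) {a<..<b} < \<infinity>"
      using rm by (simp add: emeasure_total_variation sets radon_interval_finite)
    assume ab: "a < b"
    \<comment> \<open>Any null sequence in (0, (b - a) / 2] would do.\<close>
    define h :: "nat \<Rightarrow> real" where "h k = (b - a) / (2 + real k)" for k
    have h: "0 < h k" "h k \<le> (b - a) / 2" for k
      using ab divide_left_mono[of 2 "2 + real k" "b - a"] by (simp_all add: h_def)
    have "h \<longlonglongrightarrow> 0" unfolding h_def by real_asymp
    then have "measure P {a<..<b} - measure N {a<..<b} = measure P' {a<..<b} - measure N' {a<..<b}"
      using second_distr_deriv_interval[OF f \<mu>(1) h] second_distr_deriv_interval[OF f \<mu>(2) h]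
        LIMSEQ_unique unfolding PN by fastforce
    then show "emeasure (total_variation (P, N')) {a<..<b} = emeasure (total_variation (P', N)) {a<..<b}"
      using rm by (simp add: emeasure_total_variation sets radon_interval_finite flip: ennreal_plus)
  qed simp_all
  have eq: "emeasure P E + emeasure N' E = emeasure P' E + emeasure N E" if "E \<in> sets borel" for E
    using emeasure_total_variation[of P N' E] emeasure_total_variation[of P' N E] tv sets that by simp
  obtain A where A: "A \<in> sets borel" "emeasure P (- A) = 0" "emeasure N A = 0"
    using sr(1) by (auto simp: signed_radon_measure_def)
  obtain B where B: "B \<in> sets borel" "emeasure P' (- B) = 0" "emeasure N' B = 0"
    using sr(2) by (auto simp: signed_radon_measure_def)
  have "P = P'"
  proof (rule measure_eqI)
    show "emeasure P E = emeasure P' E" if "E \<in> sets P" for E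
      using that sets jordan_parts_le[OF sets(1,2,3,4) A eq] jordan_parts_le[OF sets(3,4,1,2) B eq[symmetric]]
      by (intro antisym) auto
  qed (simp add: sets)
  moreover have "N = N'"
  proof (rule measure_eqI)
    \<comment> \<open>Exchanging the roles of the two parts replaces the separating set by its
      complement.\<close>
    have A': "- A \<in> sets borel" "emeasure N (- (- A)) = 0" "emeasure P (- A) = 0" using A by auto
    have B': "- B \<in> sets borel" "emeasure N' (- (- B)) = 0" "emeasure P' (- B) = 0" using B by auto
    have eq': "emeasure N E + emeasure P' E = emeasure N' E + emeasure P E" if "E \<in> sets borel" for E
      using eq[OF that] by (simp add: add.commute)
    show "emeasure N E = emeasure N' E" if "E \<in> sets N" for E
      using that sets jordan_parts_le[OF sets(2,1,4,3) A' eq'] jordan_parts_le[OF sets(4,3,2,1) B' eq'[symmetric]]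
      by (intro antisym) auto
  qed (simp add: sets)
  ultimately show ?thesis by (simp add: PN)
qed

lemma weighted_TV_eq:
  assumes "L-lipschitz_on UNIV f" "second_distr_deriv f (P, N)"
  shows "weighted_TV f =
    (\<integral>\<^sup>+ t. ennreal (sqrt (1 + t\<^sup>2)) \<partial>P) + (\<integral>\<^sup>+ t. ennreal (sqrt (1 + t\<^sup>2)) \<partial>N)"
proof -
  have "(THE \<mu>. second_distr_deriv f \<mu>) = (P, N)"
    using second_distr_deriv_unique[OF assms(1)] assms(2) by blast
  moreover have "radon_measure P" "radon_measure N"
    using assms(2) signed_radonD[of "(P, N)"] by (auto simp: second_distr_deriv_def)
  ultimately show ?thesis
    using assms
    by (auto simp: weighted_TV_def dest: radon_measureD(1) intro!: nn_integral_total_variation)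
qed

subsection \<open>Piecewise affine functions\<close>

definition atomic_measure :: "real set \<Rightarrow> (real \<Rightarrow> real) \<Rightarrow> real measure" where
  "atomic_measure Z v = distr (point_measure Z (\<lambda>z. ennreal (v z))) borel (\<lambda>z. z)"

lemma sets_atomic_measure [simp]: "sets (atomic_measure Z v) = sets borel"
  by (simp add: atomic_measure_def)

lemma measurable_point_measure_borel: "(\<lambda>z. z) \<in> point_measure Z v \<rightarrow>\<^sub>M (borel :: real measure)"
  by (simp add: measurable_def space_point_measure sets_point_measure)

lemma nn_integral_atomic_measure:
  assumes "finite Z" "h \<in> borel_measurable borel"
  shows "(\<integral>\<^sup>+ t. h t \<partial>atomic_measure Z v) = (\<Sum>z\<in>Z. ennreal (v z) * h z)"
  unfolding atomic_measure_def
  by (simp add: nn_integral_distr[OF measurable_point_measure_borel] assms(2)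
    nn_integral_point_measure_finite[OF assms(1)])

lemma emeasure_atomic_measure:
  assumes "finite Z" "A \<in> sets borel"
  shows "emeasure (atomic_measure Z v) A = (\<Sum>z\<in>Z. ennreal (v z) * indicator A z)"
  using nn_integral_atomic_measure[OF assms(1), of "indicator A" v] assms(2) by simp

lemma integral_atomic_measure:
  fixes h :: "real \<Rightarrow> real"
  assumes "finite Z" "h \<in> borel_measurable borel" "\<And>z. z \<in> Z \<Longrightarrow> 0 \<le> v z"
  shows "(LINT t|atomic_measure Z v. h t) = (\<Sum>z\<in>Z. v z * h z)"
  unfolding atomic_measure_def
  by (simp add: integral_distr[OF measurable_point_measure_borel assms(2)]
    lebesgue_integral_point_measure_finite[OF assms(1,3)])

lemma radon_atomic_measure:
  assumes "finite Z"
  shows "radon_measure (atomic_measure Z v)"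
  unfolding radon_measure_def
  using assms by (auto simp: emeasure_atomic_measure borel_compact ennreal_mult_less_top)

text \<open>The two parts charge disjoint sets of points, so for finite \<open>Z\<close> this is
  already a Jordan pair.\<close>

definition signed_atomic_measure :: "real set \<Rightarrow> (real \<Rightarrow> real) \<Rightarrow> signed_measure" where
  "signed_atomic_measure Z w =
     (atomic_measure Z (\<lambda>z. max 0 (w z)), atomic_measure Z (\<lambda>z. max 0 (- w z)))"

lemma signed_radon_atomic_measure:
  assumes "finite Z"
  shows "signed_radon_measure (signed_atomic_measure Z w)"
  unfolding signed_radon_measure_def signed_atomic_measure_def fst_conv snd_conv
proof (intro conjI radon_atomic_measure assms bexI)
  let ?A = "{z \<in> Z. 0 < w z}"
  show A: "?A \<in> sets borel" using assms by (intro borel_closed finite_imp_closed) simp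
  show "emeasure (atomic_measure Z (\<lambda>z. max 0 (w z))) (- ?A) = 0"
    using A assms by (subst emeasure_atomic_measure) (auto simp: indicator_def intro!: sum.neutral)
  show "emeasure (atomic_measure Z (\<lambda>z. max 0 (- w z))) ?A = 0"
    using A assms by (subst emeasure_atomic_measure) (auto simp: indicator_def intro!: sum.neutral)
qed

lemma signed_integral_atomic_measure:
  assumes "finite Z" "h \<in> borel_measurable borel"
  shows "signed_integral (signed_atomic_measure Z w) h = (\<Sum>z\<in>Z. w z * h z)"
proof -
  have "max 0 (w z) * h z - max 0 (- w z) * h z = w z * h z" for z
    by (simp add: max_def)
  then show ?thesis
    using assms
    by (simp add: signed_integral_def signed_atomic_measure_def integral_atomic_measure
      sum_subtractf[symmetric])
qed

section \<open>Integration by parts against test functions\<close>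

lemma deriv_eq_0_outside:
  fixes h :: "real \<Rightarrow> real"
  assumes "\<And>u. r < \<bar>u\<bar> \<Longrightarrow> h u = 0" "r < \<bar>t\<bar>"
  shows "deriv h t = 0"
proof (rule DERIV_imp_deriv, rule has_field_derivative_transform_within_open)
  show "((\<lambda>_. 0) has_real_derivative 0) (at t)" by simp
  show "open {u. r < \<bar>u\<bar>}" by (intro open_Collect_less continuous_intros)
qed (use assms in auto)

lemma test_function_derivatives_vanish:
  assumes "test_function \<phi>"
  shows "\<exists>r. \<forall>t. r < \<bar>t\<bar> \<longrightarrow> \<phi> t = 0 \<and> deriv \<phi> t = 0 \<and> deriv (deriv \<phi>) t = 0"
proof -
  have "bounded {t. \<phi> t \<noteq> 0}"
    using assms unfolding test_function_def
    by (intro bounded_subset[OF compact_imp_bounded closure_subset]) blast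
  then obtain r where r: "\<forall>t\<in>{t. \<phi> t \<noteq> 0}. norm t \<le> r"
    unfolding bounded_iff by blast
  have 0: "\<phi> t = 0" if "r < \<bar>t\<bar>" for t
  proof (rule ccontr)
    assume "\<phi> t \<noteq> 0"
    then have "norm t \<le> r" using r by blast
    then show False using that by simp
  qed
  have 1: "deriv \<phi> t = 0" if "r < \<bar>t\<bar>" for t
    using 0 that by (rule deriv_eq_0_outside)
  have "deriv (deriv \<phi>) t = 0" if "r < \<bar>t\<bar>" for t
    using 1 that by (rule deriv_eq_0_outside)
  then show ?thesis using 0 1 by blast
qed

lemma continuous_mult_test_function:
  assumes "continuous_on UNIV f" "test_function \<phi>"
  shows "integrable lborel (\<lambda>t. f t * deriv (deriv \<phi>) t)"
proof -
  obtain r where r: "\<forall>t. r < \<bar>t\<bar> \<longrightarrow> \<phi> t = 0 \<and> deriv \<phi> t = 0 \<and> deriv (deriv \<phi>) t = 0"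
    using test_function_derivatives_vanish[OF assms(2)] by (rule exE)
  have "smooth (deriv (deriv \<phi>))"
    using assms(2) by (simp add: test_function_iff smooth_deriv)
  then have "continuous_on UNIV (\<lambda>t. f t * deriv (deriv \<phi>) t)"
    by (intro continuous_intros assms smooth_continuous)
  then have "bounded_support (\<lambda>t. f t * deriv (deriv \<phi>) t)"
  proof (rule bounded_support_continuous[of _ "- r" r])
    fix t assume "t \<notin> {- r..r}"
    then have "r < \<bar>t\<bar>" by auto
    then show "f t * deriv (deriv \<phi>) t = 0" using r by simp
  qed
  then show ?thesis by (rule radon_integrable[OF radon_lborel])
qed

lemma integral_by_parts_affine:
  assumes "smooth \<phi>" "a \<le> b"
  shows "(LINT t|lborel. ((\<alpha> + \<beta> * t) * deriv (deriv \<phi>) t) * indicator {a..b} t) =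
    ((\<alpha> + \<beta> * b) * deriv \<phi> b - \<beta> * \<phi> b) - ((\<alpha> + \<beta> * a) * deriv \<phi> a - \<beta> * \<phi> a)"
proof (rule integral_FTC_Icc_real[OF assms(2)])
  fix t
  show "((\<lambda>t. (\<alpha> + \<beta> * t) * deriv \<phi> t - \<beta> * \<phi> t) has_real_derivative
      (\<alpha> + \<beta> * t) * deriv (deriv \<phi>) t) (at t)"
    by (auto intro!: derivative_eq_intros smoothD[OF assms(1)] smoothD[OF smooth_deriv[OF assms(1)]])
  show "isCont (\<lambda>t. (\<alpha> + \<beta> * t) * deriv (deriv \<phi>) t) t"
    using smooth_continuous[OF smooth_deriv[OF smooth_deriv[OF assms(1)]], of UNIV]
    by (intro continuous_intros) (simp add: continuous_on_eq_continuous_at)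
qed

lemma integral_affine_second_deriv:
  assumes "test_function \<phi>"
  shows "(LINT t|lborel. (\<alpha> + \<beta> * t) * deriv (deriv \<phi>) t) = 0"
proof -
  have s: "smooth \<phi>" using assms by (simp add: test_function_iff)
  obtain r where r: "\<forall>t. r < \<bar>t\<bar> \<longrightarrow> \<phi> t = 0 \<and> deriv \<phi> t = 0 \<and> deriv (deriv \<phi>) t = 0"
    using test_function_derivatives_vanish[OF assms] by (rule exE)
  define b where "b = \<bar>r\<bar> + 1"
  have b: "r < \<bar>b\<bar>" "r < \<bar>- b\<bar>" "- b \<le> b" by (auto simp: b_def)
  have "(\<alpha> + \<beta> * t) * deriv (deriv \<phi>) t =
      ((\<alpha> + \<beta> * t) * deriv (deriv \<phi>) t) * indicator {- b..b} t" for t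
  proof (cases "t \<in> {- b..b}")
    case False
    then have "r < \<bar>t\<bar>" by (auto simp: b_def)
    then show ?thesis using r by simp
  qed simp
  then have "(LINT t|lborel. (\<alpha> + \<beta> * t) * deriv (deriv \<phi>) t) =
      (LINT t|lborel. ((\<alpha> + \<beta> * t) * deriv (deriv \<phi>) t) * indicator {- b..b} t)"
    by (rule Bochner_Integration.integral_cong[OF refl])
  then show ?thesis
    unfolding integral_by_parts_affine[OF s b(3)] using r b by simp
qed

text \<open>The ramp is a fundamental solution of the second derivative. With \<open>b\<close> to
  the right of \<open>z\<close> and of the support of \<phi>, only the boundary term at
  \<open>z\<close> survives.\<close>

lemma integral_ramp_second_deriv:
  assumes "test_function \<phi>"
  shows "(LINT t|lborel. max 0 (t - z) * deriv (deriv \<phi>) t) = \<phi> z"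
proof -
  have s: "smooth \<phi>" using assms by (simp add: test_function_iff)
  obtain r where r: "\<forall>t. r < \<bar>t\<bar> \<longrightarrow> \<phi> t = 0 \<and> deriv \<phi> t = 0 \<and> deriv (deriv \<phi>) t = 0"
    using test_function_derivatives_vanish[OF assms] by (rule exE)
  define b where "b = \<bar>r\<bar> + \<bar>z\<bar> + 1"
  have b: "r < \<bar>b\<bar>" "z \<le> b" by (auto simp: b_def)
  have "max 0 (t - z) * deriv (deriv \<phi>) t =
      ((- z + 1 * t) * deriv (deriv \<phi>) t) * indicator {z..b} t" for t
  proof -
    consider "t < z" | "t \<in> {z..b}" | "b < t" unfolding atLeastAtMost_iff by linarith
    then show ?thesis
    proof cases
      case 3
      then have "r < \<bar>t\<bar>" by (simp add: b_def)
      then show ?thesis using r by simp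
    qed simp_all
  qed
  then have "(LINT t|lborel. max 0 (t - z) * deriv (deriv \<phi>) t) =
      (LINT t|lborel. ((- z + 1 * t) * deriv (deriv \<phi>) t) * indicator {z..b} t)"
    by (rule Bochner_Integration.integral_cong[OF refl])
  then show ?thesis
    unfolding integral_by_parts_affine[OF s b(2)] using r b by simp
qed

section \<open>The second derivative of a piecewise affine function\<close>

lemma sum_fibres:
  fixes g :: "real \<Rightarrow> real" and z :: "'i \<Rightarrow> real"
  assumes fin: "finite I"
  shows "(\<Sum>\<zeta>\<in>z ` I. (\<Sum>i\<in>{i \<in> I. z i = \<zeta>}. k i) * g \<zeta>) = (\<Sum>i\<in>I. k i * g (z i))"
proof -
  have "(\<Sum>i\<in>I. k i * g (z i)) = (\<Sum>\<zeta>\<in>z ` I. \<Sum>i\<in>{i \<in> I. z i = \<zeta>}. k i * g (z i))"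
    by (rule sum.image_gen[OF fin])
  also have "\<dots> = (\<Sum>\<zeta>\<in>z ` I. (\<Sum>i\<in>{i \<in> I. z i = \<zeta>}. k i) * g \<zeta>)"
    unfolding sum_distrib_right by (intro sum.cong) auto
  finally show ?thesis by simp
qed

context
  fixes \<alpha> \<beta> :: real and I :: "'i set" and m z :: "'i \<Rightarrow> real" and f :: "real \<Rightarrow> real"
  assumes fin: "finite I"
    and f: "f = (\<lambda>t. (\<alpha> + \<beta> * t) + (\<Sum>i\<in>I. m i * max 0 (t - z i)))"
begin

lemma piecewise_affine_lipschitz: "(\<bar>\<beta>\<bar> + (\<Sum>i\<in>I. \<bar>m i\<bar>))-lipschitz_on UNIV f"
proof (rule lipschitz_onI)
  fix s t
  have "f s - f t = \<beta> * (s - t) + (\<Sum>i\<in>I. m i * (max 0 (s - z i) - max 0 (t - z i)))"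
    by (simp add: f right_diff_distrib sum_subtractf)
  also have "\<bar>\<dots>\<bar> \<le> \<bar>\<beta> * (s - t)\<bar> + (\<Sum>i\<in>I. \<bar>m i * (max 0 (s - z i) - max 0 (t - z i))\<bar>)"
    by (intro order_trans[OF abs_triangle_ineq] add_left_mono sum_abs)
  also have "\<dots> \<le> \<bar>\<beta>\<bar> * \<bar>s - t\<bar> + (\<Sum>i\<in>I. \<bar>m i\<bar> * \<bar>s - t\<bar>)"
    by (intro add_mono sum_mono) (auto simp: abs_mult intro!: mult_left_mono)
  finally show "dist (f s) (f t) \<le> (\<bar>\<beta>\<bar> + (\<Sum>i\<in>I. \<bar>m i\<bar>)) * dist s t"
    by (simp add: dist_real_def distrib_right sum_distrib_right)
qed (simp add: sum_nonneg)

text \<open>The locations \<open>z i\<close> need not be distinct, since the kinks of adjacent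
  segments can meet at their common knot. The masses are added up there before they are split by
  sign.\<close>

definition "mass \<zeta> = (\<Sum>i\<in>{i \<in> I. z i = \<zeta>}. m i)"

lemma piecewise_affine_second_deriv: "second_distr_deriv f (signed_atomic_measure (z ` I) mass)"
  unfolding second_distr_deriv_def
proof (intro conjI allI impI signed_radon_atomic_measure)
  show "finite (z ` I)" using fin by simp
  fix \<phi> assume \<phi>: "test_function \<phi>"
  then have meas: "\<phi> \<in> borel_measurable borel"
    by (simp add: test_function_iff smooth_measurable)
  have int: "integrable lborel (\<lambda>t. (\<alpha> + \<beta> * t) * deriv (deriv \<phi>) t)"
    "integrable lborel (\<lambda>t. max 0 (t - \<zeta>) * deriv (deriv \<phi>) t)" for \<zeta>
    by (intro continuous_mult_test_function \<phi> continuous_intros)+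
  have "(LINT t|lborel. f t * (deriv ^^ 2) \<phi> t) =
     (LINT t|lborel. (\<alpha> + \<beta> * t) * deriv (deriv \<phi>) t
       + (\<Sum>i\<in>I. m i * (max 0 (t - z i) * deriv (deriv \<phi>) t)))"
    by (simp add: f numeral_2_eq_2 distrib_right sum_distrib_right mult.assoc)
  also have "\<dots> = (LINT t|lborel. (\<alpha> + \<beta> * t) * deriv (deriv \<phi>) t)
      + (LINT t|lborel. (\<Sum>i\<in>I. m i * (max 0 (t - z i) * deriv (deriv \<phi>) t)))"
    using int by (intro Bochner_Integration.integral_add Bochner_Integration.integrable_sum integrable_mult_right)
  also have "\<dots> = (\<Sum>i\<in>I. m i * \<phi> (z i))"
    using int by (simp add: Bochner_Integration.integral_sum integral_affine_second_deriv[OF \<phi>]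
      integral_ramp_second_deriv[OF \<phi>])
  also have "\<dots> = signed_integral (signed_atomic_measure (z ` I) mass) \<phi>"
    using fin meas by (simp add: signed_integral_atomic_measure mass_def sum_fibres[OF fin])
  finally show "(LINT t|lborel. f t * (deriv ^^ 2) \<phi> t) =
      signed_integral (signed_atomic_measure (z ` I) mass) \<phi>" .
qed

text \<open>Kinks of opposite sign at the same location cancel in part, which can only lower the
  cost; hence an inequality.\<close>

lemma weighted_TV_piecewise_affine_le:
  "weighted_TV f \<le> ennreal (\<Sum>i\<in>I. \<bar>m i\<bar> * sqrt (1 + (z i)\<^sup>2))"
proof -
  have "weighted_TV f = (\<Sum>\<zeta>\<in>z ` I. ennreal (max 0 (mass \<zeta>)) * ennreal (sqrt (1 + \<zeta>\<^sup>2)))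
      + (\<Sum>\<zeta>\<in>z ` I. ennreal (max 0 (- mass \<zeta>)) * ennreal (sqrt (1 + \<zeta>\<^sup>2)))"
    using weighted_TV_eq[OF piecewise_affine_lipschitz piecewise_affine_second_deriv[unfolded signed_atomic_measure_def]] fin
    by (simp add: nn_integral_atomic_measure)
  also have "\<dots> = (\<Sum>\<zeta>\<in>z ` I. ennreal (\<bar>mass \<zeta>\<bar> * sqrt (1 + \<zeta>\<^sup>2)))"
    unfolding sum.distrib[symmetric]
    by (rule sum.cong[OF refl]) (auto simp: ennreal_mult[symmetric] max_def)
  also have "\<dots> = ennreal (\<Sum>\<zeta>\<in>z ` I. \<bar>mass \<zeta>\<bar> * sqrt (1 + \<zeta>\<^sup>2))"
    by (rule sum_ennreal) simp
  also have "\<dots> \<le> ennreal (\<Sum>\<zeta>\<in>z ` I. (\<Sum>i\<in>{i \<in> I. z i = \<zeta>}. \<bar>m i\<bar>) * sqrt (1 + \<zeta>\<^sup>2))"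
    unfolding mass_def by (intro ennreal_leI sum_mono mult_right_mono sum_abs) simp
  finally show ?thesis by (simp only: sum_fibres[OF fin])
qed

end

subsection \<open>The dynamic program\<close>

definition opposite :: "real \<Rightarrow> real \<Rightarrow> real set" where
  "opposite d s = (if s > d then {..d} else if s = d then {d} else {d..})"

definition kink_weight :: "real \<Rightarrow> real" where
  "kink_weight p = sqrt (1 + p\<^sup>2)"

text \<open>The Euclidean length of the moment vector (q b - p a, b - a) of a segment. For opposite
  signs of \<open>a\<close> and \<open>b\<close> it is the cost of a single kink with these moments,
  see \<open>one_kink_location\<close>.\<close>

definition one_kink_cost :: "real \<Rightarrow> real \<Rightarrow> real \<Rightarrow> real \<Rightarrow> real" where
  "one_kink_cost p q a b = sqrt ((q * b - p * a)\<^sup>2 + (b - a)\<^sup>2)"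

text \<open>The optimal cost on a segment between knots \<open>p\<close> and \<open>q\<close>: when the relative end slopes \<open>a\<close> and
  \<open>b\<close> have the same sign, two kinks located at the knots themselves are optimal.\<close>

definition segment_cost :: "real \<Rightarrow> real \<Rightarrow> real \<Rightarrow> real \<Rightarrow> real" where
  "segment_cost p q a b =
     (if a * b \<le> 0 then one_kink_cost p q a b else kink_weight p * \<bar>a\<bar> + kink_weight q * \<bar>b\<bar>)"

lemma kink_weight_nonneg: "0 \<le> kink_weight p"
  by (simp add: kink_weight_def)

lemma one_kink_cost_commute: "one_kink_cost p q a b = one_kink_cost q p b a"
  by (simp add: one_kink_cost_def power2_commute)

lemma segment_cost_commute: "segment_cost p q a b = segment_cost q p b a"
  by (simp add: segment_cost_def one_kink_cost_commute mult.commute)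

lemma one_kink_cost_nonneg: "0 \<le> one_kink_cost p q a b"
  by (simp add: one_kink_cost_def)

lemma one_kink_cost_0_right: "one_kink_cost p q a 0 = kink_weight p * \<bar>a\<bar>"
proof -
  have "(q * 0 - p * a)\<^sup>2 + (0 - a)\<^sup>2 = (1 + p\<^sup>2) * a\<^sup>2" by algebra
  then show ?thesis by (simp add: one_kink_cost_def kink_weight_def real_sqrt_mult)
qed

lemma one_kink_cost_0_left: "one_kink_cost p q 0 b = kink_weight q * \<bar>b\<bar>"
  by (metis one_kink_cost_0_right one_kink_cost_commute)

text \<open>The moment vector of (a, b) is the one of (a', b) plus (a' - a) * (p, 1), the latter
  being the contribution of a kink at \<open>p\<close>.\<close>

lemma one_kink_cost_triangle: "one_kink_cost p q a b \<le> kink_weight p * \<bar>a - a'\<bar> + one_kink_cost p q a' b"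
proof -
  have "one_kink_cost p q a b =
      sqrt ((p * (a' - a) + (q * b - p * a'))\<^sup>2 + ((a' - a) + (b - a'))\<^sup>2)"
    by (simp add: one_kink_cost_def algebra_simps)
  also have "\<dots> \<le> sqrt ((p * (a' - a))\<^sup>2 + (a' - a)\<^sup>2) + one_kink_cost p q a' b"
    unfolding one_kink_cost_def by (rule real_sqrt_sum_squares_triangle_ineq)
  also have "(p * (a' - a))\<^sup>2 + (a' - a)\<^sup>2 = (1 + p\<^sup>2) * (a - a')\<^sup>2" by algebra
  finally show ?thesis by (simp add: kink_weight_def real_sqrt_mult)
qed

text \<open>If \<open>a\<close> and \<open>b\<close> have the same strict sign, then
  \<open>a'\<close> is zero or of the other sign, so that passing from \<open>a\<close> to
  \<open>a'\<close> crosses 0. The stretch from \<open>a\<close> to 0 pays for \<open>a\<close>, and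
  the stretch from 0 to \<open>a'\<close> together with the one-kink cost pays for
  \<open>b\<close>.\<close>

lemma segment_cost_triangle:
  assumes "a' * b \<le> 0"
  shows "segment_cost p q a b \<le> kink_weight p * \<bar>a - a'\<bar> + one_kink_cost p q a' b"
proof (cases "a * b \<le> 0")
  case True
  then show ?thesis using one_kink_cost_triangle by (simp add: segment_cost_def)
next
  case False
  have "\<bar>a - a'\<bar> = \<bar>a\<bar> + \<bar>a'\<bar>"
    using False assms by (auto simp: mult_le_0_iff abs_if)
  moreover have "kink_weight q * \<bar>b\<bar> \<le> kink_weight p * \<bar>a'\<bar> + one_kink_cost p q a' b"
    using one_kink_cost_triangle[of p q 0 b a'] by (simp add: one_kink_cost_0_left)
  ultimately show ?thesis
    using False by (simp add: segment_cost_def algebra_simps)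
qed

text \<open>The product condition alone would admit every \<open>r\<close> when
  \<open>s = d\<close>; the recursion admits only \<open>r = d\<close> there.\<close>

lemma opposite_iff: "r \<in> opposite d s \<longleftrightarrow> (s - d) * (r - d) \<le> 0 \<and> (s = d \<longrightarrow> r = d)"
  by (auto simp: opposite_def mult_le_0_iff)

lemma opposite_self: "d \<in> opposite d s"
  by (simp add: opposite_iff)

lemma closed_opposite: "closed (opposite d s)"
  by (simp add: opposite_def)

text \<open>The invariant of the recursion: an extra kink at the knot \<open>p\<close> can change
  the slope there at a price that bounds the change of the remaining cost. Nonnegativity is kept for
  coercivity.\<close>

definition kink_lipschitz :: "real \<Rightarrow> (real \<Rightarrow> real) \<Rightarrow> bool" where
  "kink_lipschitz p C \<longleftrightarrow> (\<forall>s. 0 \<le> C s) \<and> (\<forall>s t. C s \<le> kink_weight p * \<bar>s - t\<bar> + C t)"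

lemma kink_lipschitz_continuous:
  assumes "kink_lipschitz p C"
  shows "continuous_on A C"
proof (rule continuous_on_subset[OF lipschitz_on_continuous_on])
  show "(kink_weight p)-lipschitz_on UNIV C"
  proof (rule lipschitz_onI)
    show "dist (C s) (C t) \<le> kink_weight p * dist s t" for s t
      using assms abs_minus_commute[of s t] unfolding kink_lipschitz_def dist_real_def
      by (smt (verit))
  qed (rule kink_weight_nonneg)
qed simp

lemma one_kink_cost_ge: "\<bar>b - a\<bar> \<le> one_kink_cost p q a b"
  unfolding one_kink_cost_def by (rule real_le_rsqrt) simp

lemma continuous_on_one_kink_cost [continuous_intros]:
  assumes "continuous_on A f" "continuous_on A h"
  shows "continuous_on A (\<lambda>t. one_kink_cost p q (f t) (h t))"
  unfolding one_kink_cost_def by (intro continuous_intros assms)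

lemma continuous_coercive_attains_min:
  fixes h :: "'a::heine_borel \<Rightarrow> real"
  assumes "closed S" "x0 \<in> S" "continuous_on S h" "\<And>x. x \<in> S \<Longrightarrow> h x \<le> h x0 \<Longrightarrow> dist x0 x \<le> B"
  obtains x where "x \<in> S" "\<And>z. z \<in> S \<Longrightarrow> h x \<le> h z"
proof -
  have "compact (S \<inter> cball x0 B)" using assms by (intro closed_Int_compact) auto
  moreover have "x0 \<in> S \<inter> cball x0 B" using assms(2) assms(4)[of x0] by simp
  moreover have "continuous_on (S \<inter> cball x0 B) h" using assms(3) continuous_on_subset by blast
  ultimately obtain x where x: "x \<in> S \<inter> cball x0 B" "\<And>z. z \<in> S \<inter> cball x0 B \<Longrightarrow> h x \<le> h z"
    using continuous_attains_inf[of "S \<inter> cball x0 B" h] by blast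
  show ?thesis
  proof (rule that)
    show "h x \<le> h z" if "z \<in> S" for z
    proof (cases "h z \<le> h x0")
      case True
      then show ?thesis using x(2)[of z] assms(4)[OF that True] that by simp
    next
      case False
      then show ?thesis using x(2)[of x0] \<open>x0 \<in> S \<inter> cball x0 B\<close> by simp
    qed
  qed (use x in simp)
qed

section \<open>One step of the recursion, in either direction\<close>

context
  fixes p q d :: real and C c :: "real \<Rightarrow> real"
  assumes C: "kink_lipschitz q C"
    and c: "\<And>s. c s = (LEAST m. m \<in> (\<lambda>r. one_kink_cost p q (s - d) (r - d) + C r) ` opposite d s)"
begin

text \<open>\<open>LEAST\<close> denotes a minimum only once one is known to exist. The objective is
  continuous, and it is coercive because the one-kink cost is at least the change of slope.\<close>

lemma bellman_attained:
  "\<exists>r \<in> opposite d s. c s = one_kink_cost p q (s - d) (r - d) + C r \<and>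
    (\<forall>r' \<in> opposite d s. c s \<le> one_kink_cost p q (s - d) (r' - d) + C r')"
proof -
  define h where "h r = one_kink_cost p q (s - d) (r - d) + C r" for r
  obtain r where r: "r \<in> opposite d s" "\<And>r'. r' \<in> opposite d s \<Longrightarrow> h r \<le> h r'"
  proof (rule continuous_coercive_attains_min[of "opposite d s" d h "\<bar>s - d\<bar> + h d"])
    show "continuous_on (opposite d s) h"
      unfolding h_def by (intro continuous_intros kink_lipschitz_continuous[OF C])
    show "dist d r \<le> \<bar>s - d\<bar> + h d" if "h r \<le> h d" for r
      using that one_kink_cost_ge[of "r - d" "s - d" p q] C
      unfolding h_def kink_lipschitz_def dist_real_def by (smt (verit))
  qed (auto intro: closed_opposite opposite_self)
  have "c s = h r"
    unfolding c h_def[symmetric] by (rule Least_equality) (use r in auto)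
  then show ?thesis using r by (auto simp: h_def)
qed

text \<open>An inadmissible \<open>r\<close> is handled by a detour through the chord slope
  \<open>d\<close>: a kink at \<open>p\<close> leads from \<open>s\<close> to \<open>d\<close>, and
  the Lipschitz bound of \<open>C\<close> charges a kink at \<open>q\<close> for leading from
  \<open>d\<close> to \<open>r\<close>. These two kinks are what \<open>segment_cost\<close>
  counts.\<close>

lemma bellman_le: "c s \<le> segment_cost p q (s - d) (r - d) + C r"
proof -
  have d: "c s \<le> kink_weight p * \<bar>s - d\<bar> + C d"
    using bellman_attained[of s] opposite_self[of d s] by (auto simp: one_kink_cost_0_right)
  have L: "C d \<le> kink_weight q * \<bar>r - d\<bar> + C r"
    using C unfolding kink_lipschitz_def by (metis abs_minus_commute)
  consider "r \<in> opposite d s" | "s = d" | "(s - d) * (r - d) > 0"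
    unfolding opposite_iff by linarith
  then show ?thesis
  proof cases
    case 1
    then show ?thesis
      using bellman_attained[of s] by (auto simp: segment_cost_def opposite_iff)
  next
    case 2
    then show ?thesis using d L by (simp add: segment_cost_def one_kink_cost_0_left)
  next
    case 3
    then show ?thesis using d L by (simp add: segment_cost_def)
  qed
qed

text \<open>The optimal \<open>r\<close> for \<open>t\<close> may be inadmissible for
  \<open>s\<close>. As \<open>bellman_le\<close> accepts every \<open>r\<close>, it can be used for
  \<open>s\<close> all the same, and \<open>segment_cost_triangle\<close> compares the two
  costs.\<close>

lemma bellman_lipschitz: "kink_lipschitz p c"
  unfolding kink_lipschitz_def
proof (intro conjI allI)
  show "0 \<le> c s" for s
    using bellman_attained[of s] C one_kink_cost_nonneg unfolding kink_lipschitz_def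
    by (metis add_nonneg_nonneg)
  show "c s \<le> kink_weight p * \<bar>s - t\<bar> + c t" for s t
  proof -
    obtain r where "r \<in> opposite d t" "c t = one_kink_cost p q (t - d) (r - d) + C r"
      using bellman_attained[of t] by blast
    then show ?thesis
      using bellman_le[of s r] segment_cost_triangle[of "t - d" "r - d" p q "s - d"]
      by (auto simp: opposite_iff)
  qed
qed

end

section \<open>The costs \<open>tail_cost\<close> along the knots\<close>

lemma seg_cost_eq:
  "seg_cost x y j t s =
     one_kink_cost (x (j - 1)) (x j) (s - slope x y (j - 1)) (t - slope x y (j - 1))"
  by (simp add: seg_cost_def one_kink_cost_def)

lemma opp_slopes_eq: "opp_slopes x y i s = opposite (slope x y i) s"
  by (simp add: opp_slopes_def opposite_def)

lemma kink_lipschitz_0: "kink_lipschitz p (\<lambda>_. 0)"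
  by (simp add: kink_lipschitz_def kink_weight_nonneg)

context
  fixes x y :: "nat \<Rightarrow> real" and n i0 :: nat
  assumes i0: "2 \<le> i0" "i0 \<le> n"
begin

abbreviation (input) "slp \<equiv> slope x y"
abbreviation (input) "tc \<equiv> tail_cost x y n i0"
abbreviation (input) "onek s i \<equiv> one_kink_cost (x i) (x (Suc i)) (s i - slp i) (s (Suc i) - slp i)"
abbreviation (input) "segk s i \<equiv> segment_cost (x i) (x (Suc i)) (s i - slp i) (s (Suc i) - slp i)"

lemma tail_cost_right_end: "tc n = (\<lambda>_. 0)"
  by (rule ext) (simp add: tail_cost.simps[of x y n i0 n])

lemma tail_cost_left_end: "tc (Suc 0) = (\<lambda>_. 0)"
  by (rule ext) (simp add: tail_cost.simps[of x y n i0 "Suc 0"])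

lemma tail_cost_right:
  assumes "i0 \<le> i" "i < n"
  shows "tc i s = (LEAST m. m \<in> (\<lambda>r. one_kink_cost (x i) (x (Suc i)) (s - slp i) (r - slp i)
     + tc (Suc i) r) ` opposite (slp i) s)"
  using assms i0 by (subst tail_cost.simps) (simp add: seg_cost_eq opp_slopes_eq)

text \<open>Here the new slope sits at the right end of the segment. Exchanging the knots by
  symmetry turns this into an instance of the same step as on the right.\<close>

lemma tail_cost_left:
  assumes "0 < i" "Suc i < i0"
  shows "tc (Suc i) s = (LEAST m. m \<in> (\<lambda>r. one_kink_cost (x (Suc i)) (x i) (s - slp i) (r - slp i)
     + tc i r) ` opposite (slp i) s)"
  using assms i0
  by (subst tail_cost.simps) (simp add: seg_cost_eq opp_slopes_eq one_kink_cost_commute)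

text \<open>One induction carries all three claims, since each step needs the Lipschitz bound of the
  next cost. The second claim allows arbitrary slopes, as required by competitors; the third
  supplies sign-compatible optimal slopes, as required by the interpolant.\<close>

lemma tail_cost_right_bounds:
  assumes "i0 \<le> i" "i \<le> n"
  shows "kink_lipschitz (x i) (tc i)"
    and "tc i (s i) \<le> (\<Sum>j = i..<n. segk s j)"
    and "\<exists>s. s i = t \<and> tc i t = (\<Sum>j = i..<n. onek s j) \<and>
      (\<forall>j\<in>{i..<n}. (s j - slp j) * (s (Suc j) - slp j) \<le> 0)"
  using assms(2,1)
proof (induction i arbitrary: s t rule: inc_induct)
  case base
  {
    case 1 then show ?case by (simp add: tail_cost_right_end kink_lipschitz_0)
  next
    case 2 then show ?case by (simp add: tail_cost_right_end)
  next
    case 3 then show ?case by (auto simp: tail_cost_right_end)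
  }
next
  case (step i)
  note IH = step.IH
  {
    case 1
    then show ?case
      using bellman_lipschitz[OF IH(1)[OF le_SucI[OF 1]] tail_cost_right[OF 1]] step.hyps by simp
  next
    case 2
    have "tc i (s i) \<le> segk s i + tc (Suc i) (s (Suc i))"
      using bellman_le[OF IH(1)[OF le_SucI[OF 2]] tail_cost_right[OF 2]] step.hyps by simp
    also have "\<dots> \<le> (\<Sum>j = i..<n. segk s j)"
      using IH(2)[of s] step.hyps 2 by (simp add: sum.atLeast_Suc_lessThan)
    finally show ?case .
  next
    case 3
    obtain r where r: "r \<in> opposite (slp i) t"
      "tc i t = one_kink_cost (x i) (x (Suc i)) (t - slp i) (r - slp i) + tc (Suc i) r"
      using bellman_attained[OF IH(1)[OF le_SucI[OF 3]] tail_cost_right[OF 3]] step.hyps by blast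
    obtain s where s: "s (Suc i) = r" "tc (Suc i) r = (\<Sum>j = Suc i..<n. onek s j)"
      "\<forall>j\<in>{Suc i..<n}. (s j - slp j) * (s (Suc j) - slp j) \<le> 0"
      using IH(3)[of r] 3 by auto
    \<comment> \<open>The costs of the later segments do not involve the entry at \<open>i\<close>,
      which is therefore free to hold \<open>t\<close>.\<close>
    have "(\<Sum>j = Suc i..<n. onek s j) = (\<Sum>j = Suc i..<n. onek (s(i := t)) j)"
      by (rule sum.cong) auto
    then show ?case
      using r s step.hyps
      by (intro exI[of _ "s(i := t)"])
        (auto simp: sum.atLeast_Suc_lessThan[of i n] opposite_iff)
  }
qed

lemma tail_cost_left_bounds:
  assumes "Suc 0 \<le> i" "i < i0"
  shows "kink_lipschitz (x i) (tc i)"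
    and "tc i (s i) \<le> (\<Sum>j = 1..<i. segk s j)"
    and "\<exists>s. s i = t \<and> tc i t = (\<Sum>j = 1..<i. onek s j) \<and>
      (\<forall>j\<in>{1..<i}. (s j - slp j) * (s (Suc j) - slp j) \<le> 0)"
  using assms
proof (induction i arbitrary: s t rule: dec_induct)
  case base
  {
    case 1 then show ?case by (simp add: tail_cost_left_end kink_lipschitz_0)
  next
    case 2 then show ?case by (simp add: tail_cost_left_end)
  next
    case 3 then show ?case by (auto simp: tail_cost_left_end)
  }
next
  case (step i)
  note IH = step.IH
  {
    case 1
    then show ?case
      using bellman_lipschitz[OF IH(1)[OF Suc_lessD[OF 1]] tail_cost_left[OF _ 1]] step.hyps by simp
  next
    case 2
    have "tc (Suc i) (s (Suc i)) \<le> segk s i + tc i (s i)"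
      using bellman_le[OF IH(1)[OF Suc_lessD[OF 2]] tail_cost_left[OF _ 2], of "s (Suc i)" "s i"] step.hyps
      by (simp add: segment_cost_commute)
    also have "\<dots> \<le> (\<Sum>j = 1..<Suc i. segk s j)"
      using IH(2)[of s] step.hyps 2 by simp
    finally show ?case by simp
  next
    case 3
    obtain r where r: "r \<in> opposite (slp i) t"
      "tc (Suc i) t = one_kink_cost (x (Suc i)) (x i) (t - slp i) (r - slp i) + tc i r"
      using bellman_attained[OF IH(1)[OF Suc_lessD[OF 3]] tail_cost_left[OF _ 3]] step.hyps
      by (auto simp: less_le_trans)
    obtain s where s: "s i = r" "tc i r = (\<Sum>j = 1..<i. onek s j)"
      "\<forall>j\<in>{1..<i}. (s j - slp j) * (s (Suc j) - slp j) \<le> 0"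
      using IH(3)[of r] 3 by auto
    have "(\<Sum>j = 1..<i. onek s j) = (\<Sum>j = 1..<i. onek (s(Suc i := t)) j)"
      by (rule sum.cong) auto
    then show ?case
      using r s step.hyps
      by (intro exI[of _ "s(Suc i := t)"])
        (auto simp: one_kink_cost_commute opposite_iff mult.commute less_Suc_eq)
  }
qed

section \<open>Joining the two recursions\<close>

definition "join_cost = (\<lambda>(s, t). seg_cost x y i0 t s + tc (i0 - 1) s + tc i0 t)"

lemma Lambda_iff:
  "(s, t) \<in> Lambda x y i0 \<longleftrightarrow>
     (s - slp (i0 - 1)) * (t - slp (i0 - 1)) < 0 \<or> s = slp (i0 - 1) \<and> t = slp (i0 - 1)"
  by (auto simp: Lambda_def Let_def mult_less_0_iff)

lemma join_cost_eq: "join_cost (s, t) =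
    one_kink_cost (x (i0 - 1)) (x i0) (s - slp (i0 - 1)) (t - slp (i0 - 1)) + tc (i0 - 1) s + tc i0 t"
  by (simp add: join_cost_def seg_cost_eq)

lemma lipschitz_join: "kink_lipschitz (x (i0 - 1)) (tc (i0 - 1))" "kink_lipschitz (x i0) (tc i0)"
  using i0 by (auto intro: tail_cost_left_bounds tail_cost_right_bounds)

text \<open>If one slope equals the chord slope, the one-kink cost is that of a kink at the other
  knot. By the Lipschitz bound this pays for moving the other slope to the chord slope too.\<close>

lemma join_cost_boundary:
  assumes "(s - slp (i0 - 1)) * (t - slp (i0 - 1)) = 0"
  shows "join_cost (slp (i0 - 1), slp (i0 - 1)) \<le> join_cost (s, t)"
proof -
  let ?d = "slp (i0 - 1)"
  have "tc (i0 - 1) ?d \<le> kink_weight (x (i0 - 1)) * \<bar>?d - s\<bar> + tc (i0 - 1) s"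
    "tc i0 ?d \<le> kink_weight (x i0) * \<bar>?d - t\<bar> + tc i0 t"
    using lipschitz_join unfolding kink_lipschitz_def by blast+
  then show ?thesis
    using assms
    by (auto simp: join_cost_eq one_kink_cost_0_left one_kink_cost_0_right abs_minus_commute)
qed

text \<open>\<open>Lambda\<close> is not closed, so compactness is applied to the closed set
  \<open>S\<close> of pairs with nonpositive product; a minimiser outside \<open>Lambda\<close> is
  then replaced by the corner, using \<open>join_cost_boundary\<close>.\<close>

lemma join_cost_attained: "\<exists>a b. is_arg_min join_cost (\<lambda>p. p \<in> Lambda x y i0) (a, b)"
proof -
  let ?d = "slp (i0 - 1)"
  define S where "S = {p :: real \<times> real. (fst p - ?d) * (snd p - ?d) \<le> 0}"
  let ?B = "join_cost (?d, ?d)"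
  have nonneg: "0 \<le> tc (i0 - 1) s" "0 \<le> tc i0 s" for s
    using lipschitz_join unfolding kink_lipschitz_def by blast+
  obtain p where p: "p \<in> S" "\<And>z. z \<in> S \<Longrightarrow> join_cost p \<le> join_cost z"
  proof (rule continuous_coercive_attains_min[of S "(?d, ?d)" join_cost "?B"])
    show "closed S" unfolding S_def by (intro closed_Collect_le continuous_intros)
    have "join_cost = (\<lambda>p. one_kink_cost (x (i0 - 1)) (x i0) (fst p - ?d) (snd p - ?d)
        + tc (i0 - 1) (fst p) + tc i0 (snd p))"
      by (auto simp: join_cost_eq)
    moreover have "continuous_on S (\<lambda>p. tc (i0 - 1) (fst p))" "continuous_on S (\<lambda>p. tc i0 (snd p))"
      by (rule continuous_on_compose2[OF kink_lipschitz_continuous[OF lipschitz_join(1), of UNIV]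
            continuous_on_fst[OF continuous_on_id] subset_UNIV]
          continuous_on_compose2[OF kink_lipschitz_continuous[OF lipschitz_join(2), of UNIV]
            continuous_on_snd[OF continuous_on_id] subset_UNIV])+
    ultimately show "continuous_on S join_cost"
      by (simp only:) (intro continuous_intros)
    show "dist (?d, ?d) z \<le> ?B" if z: "z \<in> S" "join_cost z \<le> ?B" for z
    proof -
      obtain s t where st: "z = (s, t)" by fastforce
      have "dist (?d, ?d) (s, t) = sqrt ((s - ?d)\<^sup>2 + (t - ?d)\<^sup>2)"
        by (simp add: dist_Pair_Pair dist_real_def power2_commute)
      \<comment> \<open>On \<open>S\<close> the mixed term has the favourable sign, so the change of
        slope alone controls the distance to the corner.\<close>
      also have "\<dots> \<le> sqrt ((t - s)\<^sup>2)"
      proof (rule real_sqrt_le_mono)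
        have "(t - s)\<^sup>2 = (s - ?d)\<^sup>2 + (t - ?d)\<^sup>2 - 2 * ((s - ?d) * (t - ?d))" by algebra
        then show "(s - ?d)\<^sup>2 + (t - ?d)\<^sup>2 \<le> (t - s)\<^sup>2" using z(1) st by (simp add: S_def)
      qed
      also have "\<dots> \<le> ?B"
        using one_kink_cost_ge[of "t - ?d" "s - ?d" "x (i0 - 1)" "x i0"] z(2) nonneg[of s] nonneg[of t]
        by (simp add: st join_cost_eq)
      finally show ?thesis by (simp add: st)
    qed
  qed (auto simp: S_def)
  obtain s t where st: "p = (s, t)" by fastforce
  have le: "join_cost p \<le> join_cost z" if "z \<in> Lambda x y i0" for z
    using p(2)[of z] that by (cases z) (auto simp: Lambda_iff S_def)
  show ?thesis
  proof (cases "p \<in> Lambda x y i0")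
    case True
    then have "is_arg_min join_cost (\<lambda>p. p \<in> Lambda x y i0) (s, t)"
      using le unfolding is_arg_min_linorder st by blast
    then show ?thesis by blast
  next
    case False
    then have "join_cost (?d, ?d) \<le> join_cost p"
      using p(1) join_cost_boundary[of s t] by (auto simp: st Lambda_iff S_def)
    then have "join_cost (?d, ?d) \<le> join_cost z" if "z \<in> Lambda x y i0" for z
      using le[OF that] by linarith
    moreover have "(?d, ?d) \<in> Lambda x y i0" by (simp add: Lambda_iff)
    ultimately have "is_arg_min join_cost (\<lambda>p. p \<in> Lambda x y i0) (?d, ?d)"
      unfolding is_arg_min_linorder by blast
    then show ?thesis by blast
  qed
qed

lemma sum_split_join:
  "(\<Sum>j = 1..<n. h j) = (\<Sum>j = 1..<i0 - 1. h j) + h (i0 - 1) + (\<Sum>j = i0..<n. h j)" for h :: "nat \<Rightarrow> real"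
proof -
  have "(\<Sum>j = 1..<n. h j) = (\<Sum>j = 1..<i0 - 1. h j) + (\<Sum>j = i0 - 1..<n. h j)"
    using i0 by (intro sum.atLeastLessThan_concat[symmetric]) auto
  also have "(\<Sum>j = i0 - 1..<n. h j) = h (i0 - 1) + (\<Sum>j = i0..<n. h j)"
    using i0 by (subst sum.atLeast_Suc_lessThan) auto
  finally show ?thesis by simp
qed

text \<open>The minimum is caught between two sums. It equals the one-kink cost of a sign-compatible
  slope sequence, from which an interpolant can be built, and it is below the
  \<open>segment_cost\<close> of every slope sequence, in particular that of a competitor.\<close>

lemma dynamic_program:
  obtains a b s where "is_arg_min join_cost (\<lambda>p. p \<in> Lambda x y i0) (a, b)"
    "join_cost (a, b) = (\<Sum>j = 1..<n. onek s j)"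
    "\<And>j. j \<in> {1..<n} \<Longrightarrow> (s j - slp j) * (s (Suc j) - slp j) \<le> 0"
    "\<And>s. join_cost (a, b) \<le> (\<Sum>j = 1..<n. segk s j)"
proof -
  obtain a b where ab: "is_arg_min join_cost (\<lambda>p. p \<in> Lambda x y i0) (a, b)"
    using join_cost_attained by blast
  have i1: "Suc 0 \<le> i0 - 1" "i0 - 1 < i0" using i0 by auto
  obtain s1 where s1: "s1 (i0 - 1) = a" "tc (i0 - 1) a = (\<Sum>j = 1..<i0 - 1. onek s1 j)"
      "\<forall>j\<in>{1..<i0 - 1}. (s1 j - slp j) * (s1 (Suc j) - slp j) \<le> 0"
    using tail_cost_left_bounds(3)[OF i1] by auto
  obtain s2 where s2: "s2 i0 = b" "tc i0 b = (\<Sum>j = i0..<n. onek s2 j)"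
      "\<forall>j\<in>{i0..<n}. (s2 j - slp j) * (s2 (Suc j) - slp j) \<le> 0"
    using tail_cost_right_bounds(3)[of i0 b] i0 by auto
  define s where "s j = (if j < i0 then s1 j else s2 j)" for j
  have i01: "Suc (i0 - 1) = i0" using i0 by simp
  show ?thesis
  proof (rule that[OF ab, of s])
    have left: "(\<Sum>j = 1..<i0 - 1. onek s1 j) = (\<Sum>j = 1..<i0 - 1. onek s j)"
      and right: "(\<Sum>j = i0..<n. onek s2 j) = (\<Sum>j = i0..<n. onek s j)"
      by (auto simp: s_def intro!: sum.cong)
    have "onek s (i0 - 1) = one_kink_cost (x (i0 - 1)) (x i0) (a - slp (i0 - 1)) (b - slp (i0 - 1))"
      using i0 s1(1) s2(1) unfolding i01 by (simp add: s_def)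
    then show "join_cost (a, b) = (\<Sum>j = 1..<n. onek s j)"
      unfolding sum_split_join join_cost_eq s1(2) s2(2) left right by simp
    show "(s j - slp j) * (s (Suc j) - slp j) \<le> 0" if "j \<in> {1..<n}" for j
    proof -
      consider "Suc j < i0" | "j = i0 - 1" | "i0 \<le> j" by linarith
      then show ?thesis
      proof cases
        case 2
        then show ?thesis
          using ab i0 s1(1) s2(1) by (auto simp: s_def is_arg_min_def Lambda_iff)
      qed (use that s1(3) s2(3) in \<open>auto simp: s_def\<close>)
    qed
    show "join_cost (a, b) \<le> (\<Sum>j = 1..<n. segk s j)" for s
    proof -
      let ?d = "slp (i0 - 1)"
      have in_Lambda: "join_cost (a, b) \<le> join_cost z" if "z \<in> Lambda x y i0" for z
        using ab that unfolding is_arg_min_linorder by blast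
      have "join_cost (a, b) \<le> segk s (i0 - 1) + tc (i0 - 1) (s (i0 - 1)) + tc i0 (s i0)"
      proof (cases "(s (i0 - 1) - ?d) * (s i0 - ?d) \<le> 0")
        case True
        have "join_cost (a, b) \<le> join_cost (s (i0 - 1), s i0)"
        proof (cases "(s (i0 - 1) - ?d) * (s i0 - ?d) = 0")
          case True
          have "join_cost (a, b) \<le> join_cost (?d, ?d)" by (rule in_Lambda) (simp add: Lambda_iff)
          also have "\<dots> \<le> join_cost (s (i0 - 1), s i0)" by (rule join_cost_boundary[OF True])
          finally show ?thesis .
        next
          case False
          with True have "(s (i0 - 1) - ?d) * (s i0 - ?d) < 0" by linarith
          then show ?thesis by (intro in_Lambda) (unfold Lambda_iff, blast)
        qed
        then show ?thesis using True i01 by (simp add: segment_cost_def join_cost_eq)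
      next
        case False
        \<comment> \<open>Both slopes lie strictly on the same side of the chord slope; the two knot
          kinks counted by \<open>segment_cost\<close> pay for moving both to it, and the corner
          belongs to \<open>Lambda\<close>.\<close>
        have "join_cost (a, b) \<le> tc (i0 - 1) ?d + tc i0 ?d"
          using in_Lambda[of "(?d, ?d)"] by (simp add: Lambda_iff join_cost_eq one_kink_cost_0_left)
        moreover have "tc (i0 - 1) ?d \<le> kink_weight (x (i0 - 1)) * \<bar>?d - s (i0 - 1)\<bar> + tc (i0 - 1) (s (i0 - 1))"
          "tc i0 ?d \<le> kink_weight (x i0) * \<bar>?d - s i0\<bar> + tc i0 (s i0)"
          using lipschitz_join unfolding kink_lipschitz_def by blast+
        ultimately show ?thesis
          using False i01 by (simp add: segment_cost_def abs_minus_commute)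
      qed
      also have "\<dots> \<le> (\<Sum>j = 1..<n. segk s j)"
        using tail_cost_left_bounds(2)[OF i1, of s] tail_cost_right_bounds(2)[OF order_refl i0(2), of s]
        unfolding sum_split_join by linarith
      finally show ?thesis .
    qed
  qed
qed

end

subsection \<open>Duality on the segments\<close>

text \<open>The weight is the length of the vector (1, u), hence 1-Lipschitz.\<close>

lemma kink_weight_lipschitz: "kink_weight q - \<bar>q - u\<bar> \<le> kink_weight u"
  using real_sqrt_sum_squares_triangle_ineq[of 1 0 u "q - u"] by (simp add: kink_weight_def)

lemma abs_le_kink_weight: "\<bar>q\<bar> \<le> kink_weight q"
  unfolding kink_weight_def by (rule real_le_rsqrt) simp

text \<open>An affine function below the weight in absolute value certifies the lower bound
  \<open>segment_cost\<close> on a segment: it is given by the equality case of Cauchy-Schwarz for opposite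
  slopes, and by interpolation of the values \<open>\<plusminus>kink_weight\<close> with opposite signs at the knots otherwise.\<close>

lemma segment_certificate:
  assumes "p < q"
  shows "\<exists>\<alpha> \<beta>. (\<forall>u\<in>{p..q}. \<bar>\<alpha> * u + \<beta>\<bar> \<le> kink_weight u) \<and>
    \<alpha> * (q * b - p * a) + \<beta> * (b - a) = segment_cost p q a b"
proof (cases "a * b \<le> 0")
  case True
  define r where "r = one_kink_cost p q a b"
  have r2: "r\<^sup>2 = (q * b - p * a)\<^sup>2 + (b - a)\<^sup>2" by (simp add: r_def one_kink_cost_def)
  have r0: "0 \<le> r" by (simp add: r_def one_kink_cost_nonneg)
  show ?thesis
  \<comment> \<open>The certificate is the moment vector divided by its length. If
    \<open>r = 0\<close> the moments vanish, and division by zero gives the zero function.\<close>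
  proof (rule exI[of _ "(q * b - p * a) / r"], rule exI[of _ "(b - a) / r"], intro conjI ballI)
    fix u
    have "\<bar>(q * b - p * a) * u + (b - a)\<bar> \<le> r * kink_weight u"
    proof (rule power2_le_imp_le)
      \<comment> \<open>Lagrange's identity exhibits the defect in Cauchy-Schwarz as a
        square.\<close>
      have "(r * kink_weight u)\<^sup>2 - ((q * b - p * a) * u + (b - a))\<^sup>2 = ((q * b - p * a) - (b - a) * u)\<^sup>2"
        by (simp add: power_mult_distrib r2 kink_weight_def) algebra
      then show "\<bar>(q * b - p * a) * u + (b - a)\<bar>\<^sup>2 \<le> (r * kink_weight u)\<^sup>2"
        by (simp del: power_mult_distrib)
          (metis diff_ge_0_iff_ge zero_le_power2)
    qed (simp add: r0 kink_weight_nonneg)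
    then show "\<bar>(q * b - p * a) / r * u + (b - a) / r\<bar> \<le> kink_weight u"
      using r0 kink_weight_nonneg[of u]
      by (cases "r = 0") (simp_all add: add_divide_distrib[symmetric] divide_le_eq mult.commute)
    have "(q * b - p * a) / r * (q * b - p * a) + (b - a) / r * (b - a) = r\<^sup>2 / r"
      unfolding r2 by (simp add: power2_eq_square add_divide_distrib)
    then show "(q * b - p * a) / r * (q * b - p * a) + (b - a) / r * (b - a) = segment_cost p q a b"
      using True by (simp add: segment_cost_def r_def[symmetric] power2_eq_square)
  qed
next
  case False
  \<comment> \<open>\<open>K\<close> is the slope of the line from \<open>- kink_weight p\<close> at
    \<open>p\<close> to \<open>kink_weight q\<close> at \<open>q\<close>. It is at least 1 and the
    weight is 1-Lipschitz, so the line stays between minus and plus the weight on [p, q].\<close>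
  define K where "K = (kink_weight q + kink_weight p) / (q - p)"
  have K: "K * (q - p) = kink_weight q + kink_weight p" using assms by (simp add: K_def)
  have "q - p \<le> kink_weight q + kink_weight p"
    using abs_le_kink_weight[of q] abs_le_kink_weight[of p] by linarith
  then have K1: "1 \<le> K" using assms by (simp add: K_def)
  define \<sigma> where "\<sigma> = sgn a"
  have ab: "a = \<sigma> * \<bar>a\<bar>" "b = \<sigma> * \<bar>b\<bar>" and \<sigma>: "\<bar>\<sigma>\<bar> = 1" "\<sigma> * \<sigma> = 1"
    using False by (auto simp: \<sigma>_def sgn_if mult_le_0_iff)
  show ?thesis
  proof (rule exI[of _ "\<sigma> * K"], rule exI[of _ "\<sigma> * (- kink_weight p - K * p)"], intro conjI ballI)
    fix u assume u: "u \<in> {p..q}"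
    have "K * (u - p) - kink_weight p = kink_weight q - K * (q - u)"
      using K by (simp add: algebra_simps)
    moreover have "q - u \<le> K * (q - u)" "u - p \<le> K * (u - p)"
      using K1 u mult_right_mono[of 1 K "q - u"] mult_right_mono[of 1 K "u - p"] by auto
    ultimately have "\<bar>K * (u - p) - kink_weight p\<bar> \<le> kink_weight u"
      using kink_weight_lipschitz[of q u] kink_weight_lipschitz[of p u] u by auto
    moreover have "\<sigma> * K * u + \<sigma> * (- kink_weight p - K * p) = \<sigma> * (K * (u - p) - kink_weight p)"
      by (simp add: algebra_simps)
    ultimately show "\<bar>\<sigma> * K * u + \<sigma> * (- kink_weight p - K * p)\<bar> \<le> kink_weight u"
      using \<sigma> by (simp only: abs_mult) simp
  next
    \<comment> \<open>Pairing an affine function l with the moments gives l(q) b - l(p) a, so only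
      its values at the two knots matter; \<sigma> matches them to the common sign of
      \<open>a\<close> and \<open>b\<close>.\<close>
    have "\<sigma> * K * (q * b - p * a) + \<sigma> * (- kink_weight p - K * p) * (b - a) =
        (\<sigma> * b) * (K * (q - p) - kink_weight p) + kink_weight p * (\<sigma> * a)"
      by (simp add: algebra_simps)
    also have "\<sigma> * a = \<bar>a\<bar>"
      using ab(1) \<sigma>(2) by (metis mult.assoc mult_1)
    also have "\<sigma> * b = \<bar>b\<bar>"
      using ab(2) \<sigma>(2) by (metis mult.assoc mult_1)
    finally show "\<sigma> * K * (q * b - p * a) + \<sigma> * (- kink_weight p - K * p) * (b - a) = segment_cost p q a b"
      using False by (simp add: segment_cost_def K mult.commute)
  qed
qed

lemma bounded_support_affine_indicator:
  fixes a b :: real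
  shows "bounded_support (\<lambda>u. (\<alpha> * u + \<beta>) * indicator {a..<b} u)"
proof (rule bounded_supportI[of _ "\<bar>\<alpha>\<bar> * max \<bar>a\<bar> \<bar>b\<bar> + \<bar>\<beta>\<bar>" a b])
  show "\<bar>(\<alpha> * u + \<beta>) * indicator {a..<b} u\<bar> \<le> \<bar>\<alpha>\<bar> * max \<bar>a\<bar> \<bar>b\<bar> + \<bar>\<beta>\<bar>" for u
  proof (cases "u \<in> {a..<b}")
    case True
    then have "\<bar>u\<bar> \<le> max \<bar>a\<bar> \<bar>b\<bar>" by auto
    then have "\<bar>\<alpha> * u\<bar> \<le> \<bar>\<alpha>\<bar> * max \<bar>a\<bar> \<bar>b\<bar>" by (simp add: abs_mult mult_left_mono)
    then show ?thesis using True abs_triangle_ineq[of "\<alpha> * u" \<beta>] by simp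
  qed simp
qed (auto simp: indicator_def)

text \<open>Here \<open>s\<close> is the left derivative of \<open>f\<close> on \<open>{A<..B}\<close>.\<close>

lemma second_distr_deriv_slopes:
  assumes f: "L-lipschitz_on UNIV f" and \<mu>: "second_distr_deriv f \<mu>" and AB: "A < B"
  obtains s where
    "\<And>p q. A \<le> p \<Longrightarrow> p < q \<Longrightarrow> q \<le> B \<Longrightarrow>
      signed_integral \<mu> (indicator {p..<q}) = s q - s p \<and>
      signed_integral \<mu> (\<lambda>u. u * indicator {p..<q} u) =
        q * (s q - (f q - f p) / (q - p)) - p * (s p - (f q - f p) / (q - p))"
proof -
  have sr: "signed_radon_measure \<mu>" using \<mu> by (simp add: second_distr_deriv_def)
  note add = signed_integral_add[OF sr] and cmult = signed_integral_cmult
  have bs: "bounded_support (indicator {p..<q} :: real \<Rightarrow> real)"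
    "bounded_support (\<lambda>u. u * indicator {p..<q} u)" for p q :: real
    using bounded_support_affine_indicator[of 0 1 p q] bounded_support_affine_indicator[of 1 0 p q]
    by simp_all
  \<comment> \<open>Up to sign this is the Green function of [A, B] with zero boundary values:
    pairing it with \<mu> yields \<open>f t\<close> minus the value at \<open>t\<close> of the chord
    of \<open>f\<close> from \<open>A\<close> to \<open>B\<close>.\<close>
  define G where "G t u = (\<Sum>j\<in>{0, 1, 2::nat}. (if j = 0 then 1 else if j = 1 then (t - B) / (B - A) else (A - t) / (B - A))
      * max 0 (u - (if j = 0 then t else if j = 1 then A else B)))" for t u
  have G: "signed_integral \<mu> (G t) = f t + (t - B) / (B - A) * f A + (A - t) / (B - A) * f B"
    "bounded_support (G t)" "u \<notin> {A..B} \<Longrightarrow> G t u = 0"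
    if "A \<le> t" "t \<le> B" for t u
  proof -
    let ?c = "\<lambda>j::nat. if j = 0 then 1 else if j = 1 then (t - B) / (B - A) else (A - t) / (B - A)"
    let ?p = "\<lambda>j::nat. if j = 0 then t else if j = 1 then A else B"
    have c: "(\<Sum>j\<in>{0, 1, 2}. ?c j) = 0" "(\<Sum>j\<in>{0, 1, 2}. ?c j * ?p j) = 0"
    proof -
      have "(t - B) * A + (A - t) * B = - t * (B - A)" "t - B + (A - t) = - (B - A)" by algebra+
      then have "(t - B) / (B - A) + (A - t) / (B - A) = - 1"
        "(t - B) / (B - A) * A + (A - t) / (B - A) * B = - t"
        using AB by (simp_all add: add_divide_distrib[symmetric] divide_eq_minus_1_iff)
      then show "(\<Sum>j\<in>{0, 1, 2}. ?c j) = 0" "(\<Sum>j\<in>{0, 1, 2}. ?c j * ?p j) = 0"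
        by (simp_all del: times_divide_eq_left)
    qed
    have p: "?p j \<in> {A..B}" for j using that AB by auto
    show "signed_integral \<mu> (G t) = f t + (t - B) / (B - A) * f A + (A - t) / (B - A) * f B"
      unfolding G_def using second_distr_deriv_ramp_sum[OF f \<mu> c p] by simp
    show "bounded_support (G t)"
      unfolding G_def by (rule bounded_support_ramp_sum[OF c p])
    show "G t u = 0" if "u \<notin> {A..B}"
      unfolding G_def by (rule ramp_sum_eq_0[OF c p that])
  qed
  \<comment> \<open>For \<open>u\<close> in [A, B] the left derivative of \<open>G t u\<close> with
    respect to \<open>t\<close> is \<open>k u + indicator {A..<t} u\<close>. Pairing this with \<mu>
    and adding the slope of the chord suggests the formula for \<open>s t\<close> below.\<close>
  define k where "k u = (u - A) / (B - A) * indicator {A..B} u - indicator {A..B} u" for u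
  have bsk: "bounded_support k"
  proof (rule bounded_supportI[of _ 1 A B])
    show "k \<in> borel_measurable borel" unfolding k_def[abs_def] by measurable
    show "\<bar>k u\<bar> \<le> 1" for u
      using AB by (cases "u \<in> {A..B}") (auto simp: k_def abs_le_iff field_simps)
  qed (simp add: k_def)
  define D where "D = (f B - f A) / (B - A) + signed_integral \<mu> k"
  define s where "s t = D + signed_integral \<mu> (indicator {A..<t})" for t
  show ?thesis
  proof (rule that[of s], intro conjI)
    fix p q assume pq: "A \<le> p" "p < q" "q \<le> B"
    have "(indicator {A..<q} :: real \<Rightarrow> real) = (\<lambda>u. indicator {A..<p} u + indicator {p..<q} u)"
      using pq by (auto simp: indicator_def fun_eq_iff)
    then show jump: "signed_integral \<mu> (indicator {p..<q}) = s q - s p"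
      using add[OF bs(1) bs(1), of A p p q] by (simp add: s_def)
    \<comment> \<open>This is the formula for the left derivative of \<open>G\<close> integrated
      over \<open>t\<close> from \<open>p\<close> to \<open>q\<close>; the last two terms amount to
      \<open>q - u\<close> for \<open>u\<close> in [p, q).\<close>
    have Gq: "G q = (\<lambda>u. G p u + ((q - p) * k u + ((q - p) * indicator {A..<p} u
        + (q * indicator {p..<q} u + (-1) * (u * indicator {p..<q} u)))))"
    proof
      fix u
      show "G q u = G p u + ((q - p) * k u + ((q - p) * indicator {A..<p} u
        + (q * indicator {p..<q} u + (-1) * (u * indicator {p..<q} u))))"
      proof (cases "u \<in> {A..B}")
        case True
        have kk: "(q - p) * k u = (q - p) * (u - A) / (B - A) - (q - p)"
          using True by (simp add: k_def right_diff_distrib)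
        have GG: "G t u = max 0 (u - t) + (t - B) / (B - A) * (u - A)" for t
          using True by (simp add: G_def)
        have "G q u - G p u - (q - p) * (u - A) / (B - A) = max 0 (u - q) - max 0 (u - p)"
          using AB unfolding GG by (simp add: divide_simps) algebra
        then show ?thesis
          using True pq unfolding kk by (auto simp: indicator_def max_def)
      next
        case False
        then show ?thesis using G(3)[OF _ _ False] pq by (auto simp: k_def indicator_def)
      qed
    qed
    have "signed_integral \<mu> (G q) = signed_integral \<mu> (G p) + ((q - p) * signed_integral \<mu> k
        + ((q - p) * signed_integral \<mu> (indicator {A..<p}) + (q * signed_integral \<mu> (indicator {p..<q})
        + (-1) * signed_integral \<mu> (\<lambda>u. u * indicator {p..<q} u))))"
      using pq unfolding Gq
      by (simp only: add cmult G(2) bsk bs bounded_support_add bounded_support_cmult)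
    moreover have "signed_integral \<mu> (G q) - signed_integral \<mu> (G p) =
        (f q - f p) - (q - p) * ((f B - f A) / (B - A))"
      using G(1)[of q] G(1)[of p] pq AB by (simp add: divide_simps) algebra
    ultimately have "signed_integral \<mu> (\<lambda>u. u * indicator {p..<q} u) =
        q * (s q - s p) + (q - p) * s p - (f q - f p)"
      unfolding jump by (simp add: s_def D_def algebra_simps)
    also have "\<dots> = q * s q - p * s p - (q - p) * ((f q - f p) / (q - p))"
    proof -
      have "(q - p) * ((f q - f p) / (q - p)) = f q - f p" using pq by simp
      then show ?thesis by algebra
    qed
    finally show "signed_integral \<mu> (\<lambda>u. u * indicator {p..<q} u) =
        q * (s q - (f q - f p) / (q - p)) - p * (s p - (f q - f p) / (q - p))"
      by (simp only: right_diff_distrib left_diff_distrib)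
  qed
qed

lemma signed_integral_le_weighted_TV:
  assumes "L-lipschitz_on UNIV f" "second_distr_deriv f \<mu>" "bounded_support h"
    and "\<And>t. \<bar>h t\<bar> \<le> kink_weight t"
  shows "ennreal (signed_integral \<mu> h) \<le> weighted_TV f"
proof -
  obtain P N where \<mu>: "\<mu> = (P, N)" by fastforce
  have rm: "radon_measure P" "radon_measure N"
    using assms(2) signed_radonD[of "(P, N)"] by (auto simp: second_distr_deriv_def \<mu>)
  have *: "ennreal \<bar>LINT t|M. h t\<bar> \<le> (\<integral>\<^sup>+ t. ennreal (sqrt (1 + t\<^sup>2)) \<partial>M)" if "radon_measure M" for M
  proof -
    have "ennreal \<bar>LINT t|M. h t\<bar> \<le> (\<integral>\<^sup>+ t. ennreal \<bar>h t\<bar> \<partial>M)"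
      using integral_norm_bound_ennreal[OF radon_integrable[OF that assms(3)]] by simp
    also have "\<dots> \<le> (\<integral>\<^sup>+ t. ennreal (sqrt (1 + t\<^sup>2)) \<partial>M)"
      using assms(4) by (intro nn_integral_mono ennreal_leI) (simp add: kink_weight_def)
    finally show ?thesis .
  qed
  have "ennreal (signed_integral \<mu> h) \<le> ennreal (\<bar>LINT t|P. h t\<bar> + \<bar>LINT t|N. h t\<bar>)"
    by (intro ennreal_leI) (simp add: signed_integral_def \<mu>)
  also have "\<dots> = ennreal \<bar>LINT t|P. h t\<bar> + ennreal \<bar>LINT t|N. h t\<bar>" by simp
  also have "\<dots> \<le> weighted_TV f"
    unfolding weighted_TV_eq[OF assms(1) assms(2)[unfolded \<mu>]] by (intro add_mono * rm)
  finally show ?thesis .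
qed

text \<open>The two moments force mass \<open>b - a\<close> and location
  \<open>(q * b - p * a) / (b - a)\<close>. Opposite signs make the latter a convex combination of
  \<open>p\<close> and \<open>q\<close>. If \<open>a = b\<close>, both vanish and any point
  serves.\<close>

lemma one_kink_location:
  assumes "p < q" "a * b \<le> 0"
  shows "\<exists>z\<in>{p..q}. (b - a) * z = q * b - p * a \<and> \<bar>b - a\<bar> * sqrt (1 + z\<^sup>2) = one_kink_cost p q a b"
proof (cases "a = b")
  case True
  with assms have "a = 0" "b = 0" by (auto simp: mult_le_0_iff)
  then show ?thesis using assms by (intro bexI[of _ p]) (auto simp: one_kink_cost_def)
next
  case False
  define z where "z = (q * b - p * a) / (b - a)"
  have z: "(b - a) * z = q * b - p * a" using False by (simp add: z_def)
  have "p \<le> z \<and> z \<le> q"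
  proof -
    consider "a \<le> 0" "0 \<le> b" "a < b" | "0 \<le> a" "b \<le> 0" "b < a"
      using assms(2) False by (auto simp: mult_le_0_iff)
    then show ?thesis
    proof cases
      case 1
      then have "0 \<le> b * (q - p)" "0 \<le> (- a) * (q - p)"
        using assms(1) mult_nonneg_nonneg[of "- a" "q - p"] by simp_all
      then show ?thesis using 1 by (simp add: z_def field_simps)
    next
      case 2
      then have "0 \<le> (- b) * (q - p)" "0 \<le> a * (q - p)"
        using assms(1) mult_nonneg_nonneg[of "- b" "q - p"] by simp_all
      then show ?thesis using 2 by (simp add: z_def field_simps)
    qed
  qed
  moreover have "\<bar>b - a\<bar> * sqrt (1 + z\<^sup>2) = one_kink_cost p q a b"
  proof -
    have "\<bar>b - a\<bar> * sqrt (1 + z\<^sup>2) = sqrt ((b - a)\<^sup>2 * (1 + z\<^sup>2))" by (simp add: real_sqrt_mult)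
    also have "(b - a)\<^sup>2 * (1 + z\<^sup>2) = ((b - a) * z)\<^sup>2 + (b - a)\<^sup>2" by algebra
    finally show ?thesis by (simp add: z one_kink_cost_def)
  qed
  ultimately show ?thesis using z by auto
qed

lemma sum_disjoint_bound:
  fixes h :: "'i \<Rightarrow> real"
  assumes "finite I" "\<And>i j. i \<in> I \<Longrightarrow> j \<in> I \<Longrightarrow> h i \<noteq> 0 \<Longrightarrow> h j \<noteq> 0 \<Longrightarrow> i = j"
    and "\<And>i. i \<in> I \<Longrightarrow> \<bar>h i\<bar> \<le> c" "0 \<le> c"
  shows "\<bar>\<Sum>i\<in>I. h i\<bar> \<le> c"
proof (cases "\<forall>i\<in>I. h i = 0")
  case False
  then obtain i where i: "i \<in> I" "h i \<noteq> 0" by blast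
  then have "(\<Sum>j\<in>I. h j) = (\<Sum>j\<in>{i}. h j)"
    using assms(1,2) by (intro sum.mono_neutral_right) auto
  then show ?thesis using assms(3)[OF i(1)] by simp
qed (simp add: assms(4))

section \<open>Lower bound for all interpolants, and an optimal one\<close>

context
  fixes x y :: "nat \<Rightarrow> real" and n :: nat
  assumes mono: "strict_mono_on {1..n} x" and n: "2 \<le> n"
begin

lemma knots_less: "1 \<le> i \<Longrightarrow> i < j \<Longrightarrow> j \<le> n \<Longrightarrow> x i < x j"
  using mono by (auto simp: strict_mono_on_def)

lemma knots_le: "1 \<le> i \<Longrightarrow> i \<le> j \<Longrightarrow> j \<le> n \<Longrightarrow> x i \<le> x j"
  using knots_less by (cases "i = j") (auto intro: less_imp_le)

text \<open>Summing the segment certificates over half-open segments gives one function below the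
  weight, since at each point at most one summand is nonzero. Its pairing with \<mu> is the total
  \<open>segment_cost\<close> of the slopes of \<open>f\<close> at the knots.\<close>

lemma weighted_TV_lower_bound:
  assumes f: "\<forall>i\<in>{1..n}. f (x i) = y i"
    and V: "\<And>s. V \<le> (\<Sum>i = 1..<n. segment_cost (x i) (x (Suc i)) (s i - slope x y i) (s (Suc i) - slope x y i))"
  shows "ennreal V \<le> weighted_TV f"
proof (cases "(\<exists>L. L-lipschitz_on UNIV f) \<and> (\<exists>\<mu>. second_distr_deriv f \<mu>)")
  case True
  then obtain L \<mu> where L: "L-lipschitz_on UNIV f" and \<mu>: "second_distr_deriv f \<mu>" by blast
  then have sr: "signed_radon_measure \<mu>" by (simp add: second_distr_deriv_def)
  have "x 1 < x n" using n by (intro knots_less) auto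
  then obtain s where s: "\<And>p q. x 1 \<le> p \<Longrightarrow> p < q \<Longrightarrow> q \<le> x n \<Longrightarrow>
      signed_integral \<mu> (indicator {p..<q}) = s q - s p \<and>
      signed_integral \<mu> (\<lambda>u. u * indicator {p..<q} u) =
        q * (s q - (f q - f p) / (q - p)) - p * (s p - (f q - f p) / (q - p))"
    using second_distr_deriv_slopes[OF L \<mu>] by blast
  \<comment> \<open>The slope at an inner knot is the right end slope of one segment and the left
    end slope of the next, so the hypothesis on \<open>V\<close> applies to a single sequence
    \<open>s (x i)\<close>.\<close>
  define a b where "a i = s (x i) - slope x y i" and "b i = s (x (Suc i)) - slope x y i" for i
  have "\<exists>\<alpha> \<beta>. (\<forall>u\<in>{x i..x (Suc i)}. \<bar>\<alpha> * u + \<beta>\<bar> \<le> kink_weight u) \<and>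
      \<alpha> * (x (Suc i) * b i - x i * a i) + \<beta> * (b i - a i) = segment_cost (x i) (x (Suc i)) (a i) (b i)"
    if "i \<in> {1..<n}" for i
    using that by (intro segment_certificate knots_less) auto
  then obtain \<alpha> \<beta> where \<alpha>\<beta>: "\<And>i u. i \<in> {1..<n} \<Longrightarrow> u \<in> {x i..x (Suc i)} \<Longrightarrow> \<bar>\<alpha> i * u + \<beta> i\<bar> \<le> kink_weight u"
      "\<And>i. i \<in> {1..<n} \<Longrightarrow> \<alpha> i * (x (Suc i) * b i - x i * a i) + \<beta> i * (b i - a i) =
        segment_cost (x i) (x (Suc i)) (a i) (b i)"
    by metis
  define h where "h i u = (\<alpha> i * u + \<beta> i) * indicator {x i..<x (Suc i)} u" for i u
  have bs: "bounded_support (h i)" for i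
    unfolding h_def by (rule bounded_support_affine_indicator)
  have "signed_integral \<mu> (h i) = segment_cost (x i) (x (Suc i)) (a i) (b i)" if i: "i \<in> {1..<n}" for i
  proof -
    have "h i = (\<lambda>u. \<alpha> i * (u * indicator {x i..<x (Suc i)} u) + \<beta> i * indicator {x i..<x (Suc i)} u)"
      by (simp add: h_def fun_eq_iff distrib_right)
    moreover have "bounded_support (\<lambda>u. u * indicator {x i..<x (Suc i)} u)"
        "bounded_support (indicator {x i..<x (Suc i)} :: real \<Rightarrow> real)"
      using bounded_support_affine_indicator[of 1 0 "x i" "x (Suc i)"]
        bounded_support_affine_indicator[of 0 1 "x i" "x (Suc i)"] by simp_all
    ultimately have "signed_integral \<mu> (h i) =
        \<alpha> i * signed_integral \<mu> (\<lambda>u. u * indicator {x i..<x (Suc i)} u)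
        + \<beta> i * signed_integral \<mu> (indicator {x i..<x (Suc i)})"
      by (simp only: signed_integral_add[OF sr] bounded_support_cmult signed_integral_cmult)
    also have "\<dots> = \<alpha> i * (x (Suc i) * b i - x i * a i) + \<beta> i * (b i - a i)"
    proof -
      have "x 1 \<le> x i" "x i < x (Suc i)" "x (Suc i) \<le> x n"
        using i by (auto intro!: knots_le knots_less)
      from s[OF this] show ?thesis
        using f i by (simp add: a_def b_def slope_def)
    qed
    finally show ?thesis using \<alpha>\<beta>(2)[OF i] by simp
  qed
  then have "signed_integral \<mu> (\<lambda>u. \<Sum>i\<in>{1..<n}. h i u) =
      (\<Sum>i = 1..<n. segment_cost (x i) (x (Suc i)) (a i) (b i))"
    by (simp add: signed_integral_sum[OF sr bs])
  then have "ennreal V \<le> ennreal (signed_integral \<mu> (\<lambda>u. \<Sum>i\<in>{1..<n}. h i u))"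
    using V[of "\<lambda>i. s (x i)"] by (intro ennreal_leI) (simp add: a_def b_def)
  also have "\<dots> \<le> weighted_TV f"
  proof (rule signed_integral_le_weighted_TV[OF L \<mu>])
    show "bounded_support (\<lambda>u. \<Sum>i\<in>{1..<n}. h i u)" by (rule bounded_support_sum[OF bs])
    show "\<bar>\<Sum>i\<in>{1..<n}. h i u\<bar> \<le> kink_weight u" for u
    proof (rule sum_disjoint_bound)
      fix i assume i: "i \<in> {1..<n}"
      show "\<bar>h i u\<bar> \<le> kink_weight u"
        using \<alpha>\<beta>(1)[OF i, of u] kink_weight_nonneg[of u] by (cases "u \<in> {x i..<x (Suc i)}") (auto simp: h_def)
      fix j assume j: "j \<in> {1..<n}" and "h i u \<noteq> 0" "h j u \<noteq> 0"
      then have u: "x i \<le> u" "u < x (Suc i)" "x j \<le> u" "u < x (Suc j)"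
        by (auto simp: h_def indicator_def split: if_splits)
      have "\<not> i < j" using knots_le[of "Suc i" j] u i j by auto
      moreover have "\<not> j < i" using knots_le[of "Suc j" i] u i j by auto
      ultimately show "i = j" by simp
    qed (simp_all add: kink_weight_nonneg)
  qed
  finally show ?thesis .
next
  case False
  then have "weighted_TV f = \<infinity>" unfolding weighted_TV_def by (rule if_not_P)
  then show ?thesis by simp
qed

lemma interpolant_exists:
  assumes s: "\<And>i. i \<in> {1..<n} \<Longrightarrow> (s i - slope x y i) * (s (Suc i) - slope x y i) \<le> 0"
  obtains f where "\<forall>i\<in>{1..n}. f (x i) = y i"
    "weighted_TV f \<le> ennreal (\<Sum>i = 1..<n.
       one_kink_cost (x i) (x (Suc i)) (s i - slope x y i) (s (Suc i) - slope x y i))"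
proof -
  let ?d = "slope x y"
  have "\<exists>z\<in>{x i..x (Suc i)}. (s (Suc i) - s i) * z = x (Suc i) * (s (Suc i) - ?d i) - x i * (s i - ?d i) \<and>
      \<bar>s (Suc i) - s i\<bar> * sqrt (1 + z\<^sup>2) = one_kink_cost (x i) (x (Suc i)) (s i - ?d i) (s (Suc i) - ?d i)"
    if i: "i \<in> {1..<n}" for i
  proof -
    have "x i < x (Suc i)" using i by (intro knots_less) auto
    from one_kink_location[OF this s[OF i]] show ?thesis by simp
  qed
  then obtain z where z: "\<And>i. i \<in> {1..<n} \<Longrightarrow> z i \<in> {x i..x (Suc i)}"
    "\<And>i. i \<in> {1..<n} \<Longrightarrow> (s (Suc i) - s i) * z i = x (Suc i) * (s (Suc i) - ?d i) - x i * (s i - ?d i)"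
    "\<And>i. i \<in> {1..<n} \<Longrightarrow> \<bar>s (Suc i) - s i\<bar> * sqrt (1 + (z i)\<^sup>2) =
        one_kink_cost (x i) (x (Suc i)) (s i - ?d i) (s (Suc i) - ?d i)"
    by metis
  \<comment> \<open>Start with the line of slope \<open>s 1\<close> through the first data point,
    then bend it once in each segment by the change of slope prescribed there.\<close>
  define f where "f = (\<lambda>t. ((y 1 - s 1 * x 1) + s 1 * t) + (\<Sum>i\<in>{1..<n}. (s (Suc i) - s i) * max 0 (t - z i)))"
  show ?thesis
  proof (rule that[of f])
    show "\<forall>i\<in>{1..n}. f (x i) = y i"
    proof
      fix k assume k: "k \<in> {1..n}"
      then have k1: "1 \<le> k" by simp
      have "(\<Sum>i\<in>{1..<n}. (s (Suc i) - s i) * max 0 (x k - z i)) =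
          (\<Sum>i\<in>{1..<k}. (s (Suc i) - s i) * x k - (s (Suc i) - s i) * z i)"
      proof (rule sum.mono_neutral_cong_right)
        \<comment> \<open>Kinks of segments to the right of \<open>x k\<close> have not acted yet;
          those to the left are past their bend, where the ramp is affine.\<close>
        show "\<forall>i\<in>{1..<n} - {1..<k}. (s (Suc i) - s i) * max 0 (x k - z i) = 0"
        proof
          fix i assume i: "i \<in> {1..<n} - {1..<k}"
          then have "x k \<le> x i" using k by (intro knots_le) auto
          then have "x k - z i \<le> 0" using z(1)[of i] i by auto
          then show "(s (Suc i) - s i) * max 0 (x k - z i) = 0" by simp
        qed
        fix i assume i: "i \<in> {1..<k}"
        then have "x (Suc i) \<le> x k" using k by (intro knots_le) auto
        then have "0 \<le> x k - z i" using z(1)[of i] i k by auto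
        then show "(s (Suc i) - s i) * max 0 (x k - z i) = (s (Suc i) - s i) * x k - (s (Suc i) - s i) * z i"
          by (simp add: right_diff_distrib)
      qed (use k in auto)
      \<comment> \<open>After the first \<open>k - 1\<close> kinks the accumulated line passes
        through the data point \<open>k\<close> with slope \<open>s k\<close>. The first-moment
        equation for \<open>z j\<close> makes the induction step work.\<close>
      moreover have "y 1 - s 1 * x 1 + s 1 * t
          + (\<Sum>i\<in>{1..<k}. (s (Suc i) - s i) * t - (s (Suc i) - s i) * z i) = y k + s k * (t - x k)" for t
        using k1 k
      proof (induction k rule: dec_induct)
        case (step j)
        have jn: "j \<in> {1..<n}" using step by auto
        have "x j < x (Suc j)" using jn by (intro knots_less) auto
        then have "(x (Suc j) - x j) * ?d j = y (Suc j) - y j" by (simp add: slope_def)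
        then show ?case using step z(2)[OF jn] by (simp add: algebra_simps)
      qed (simp_all add: algebra_simps)
      ultimately show "f (x k) = y k" by (simp add: f_def)
    qed
    have "weighted_TV f \<le> ennreal (\<Sum>i\<in>{1..<n}. \<bar>s (Suc i) - s i\<bar> * sqrt (1 + (z i)\<^sup>2))"
      by (rule weighted_TV_piecewise_affine_le[OF _ f_def]) simp
    also have "(\<Sum>i\<in>{1..<n}. \<bar>s (Suc i) - s i\<bar> * sqrt (1 + (z i)\<^sup>2)) =
        (\<Sum>i = 1..<n. one_kink_cost (x i) (x (Suc i)) (s i - ?d i) (s (Suc i) - ?d i))"
      using z(3) by (rule sum.cong[OF refl])
    finally show "weighted_TV f \<le> ennreal (\<Sum>i = 1..<n.
       one_kink_cost (x i) (x (Suc i)) (s i - ?d i) (s (Suc i) - ?d i))" .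
  qed
qed

end

theorem lemma2:
  fixes x y :: "nat \<Rightarrow> real" and n i0 :: nat
  assumes "1 \<le> n"
    and "strict_mono_on {1..n} x"
    and "x 1 < 0" and "0 \<le> x n"
    and "i0 = Min {i \<in> {1..n}. 0 \<le> x i}"
  shows "\<exists>f a b.
    is_arg_min weighted_TV (\<lambda>f. \<forall>i\<in>{1..n}. f (x i) = y i) f \<and>
    is_arg_min
      (\<lambda>(s, t). seg_cost x y i0 t s + tail_cost x y n i0 (i0 - 1) s + tail_cost x y n i0 i0 t)
      (\<lambda>p. p \<in> Lambda x y i0) (a, b) \<and>
    weighted_TV f =
      ennreal (seg_cost x y i0 b a + tail_cost x y n i0 (i0 - 1) a + tail_cost x y n i0 i0 b)"
proof -
  have "i0 \<in> {i \<in> {1..n}. 0 \<le> x i}"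
    unfolding assms(5) using assms(1,4) by (intro Min_in) auto
  \<comment> \<open>The sign of \<open>x 1\<close> excludes index 1, so there is a knot on the left
    of the join.\<close>
  then have "i0 \<noteq> 1" "1 \<le> i0" "i0 \<le> n" using assms(3) by auto
  then have i0: "2 \<le> i0" "i0 \<le> n" and n: "2 \<le> n" by auto
  obtain a b s where ab: "is_arg_min (join_cost x y n i0) (\<lambda>p. p \<in> Lambda x y i0) (a, b)"
    and s: "join_cost x y n i0 (a, b) = (\<Sum>j = 1..<n.
        one_kink_cost (x j) (x (Suc j)) (s j - slope x y j) (s (Suc j) - slope x y j))"
      "\<And>j. j \<in> {1..<n} \<Longrightarrow> (s j - slope x y j) * (s (Suc j) - slope x y j) \<le> 0"
    and lower: "\<And>s. join_cost x y n i0 (a, b) \<le> (\<Sum>j = 1..<n.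
        segment_cost (x j) (x (Suc j)) (s j - slope x y j) (s (Suc j) - slope x y j))"
    by (rule dynamic_program[OF i0, where x = x and y = y]) blast
  obtain f where f: "\<forall>i\<in>{1..n}. f (x i) = y i" "weighted_TV f \<le> ennreal (join_cost x y n i0 (a, b))"
    unfolding s(1) using interpolant_exists[OF assms(2) n s(2)] by blast
  have lower': "ennreal (join_cost x y n i0 (a, b)) \<le> weighted_TV g" if "\<forall>i\<in>{1..n}. g (x i) = y i" for g
    by (rule weighted_TV_lower_bound[OF assms(2) n that lower])
  \<comment> \<open>The construction bounds the cost of \<open>f\<close> only from above; the lower
    bound applied to \<open>f\<close> itself gives equality.\<close>
  have eq: "weighted_TV f = ennreal (join_cost x y n i0 (a, b))"
    using f lower' by (intro antisym) auto
  have "is_arg_min weighted_TV (\<lambda>f. \<forall>i\<in>{1..n}. f (x i) = y i) f"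
    unfolding is_arg_min_linorder using f(1) lower' eq by simp
  then show ?thesis
    using ab eq by (intro exI[of _ f] exI[of _ a] exI[of _ b]) (simp add: join_cost_def[OF i0])
qed

end
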